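(* Let $K$ be a field, $S=K[x_1,\dots,x_n]$, and let $a_1\le a_2\le\cdots\le a_t$ be integers, $t\ge 1$. If $M$ is a (proper) monomial ideal of $S$ containing a regular sequence $f_1,\dots,f_t$ of homogeneous polynomials with $\deg(f_i)=a_i$ for all $1\le i\le t$, then there exists a monomial ideal $J$ of $S$ containing $x_1^{a_1},\dots,x_t^{a_t}$ such that $M$ and $J$ have the same Hilbert function, i.e. $H(S/M,d)=H(S/J,d)$ for all $d\ge 0$.
   Context: $S=K[x_1,\dots,x_n]$ has the standard grading with $\deg x_i=1$. A graded ideal is a proper ideal generated by homogeneous elements; it is called monomial if it has a system of monomial generators. For a graded ideal $I$, $H(S/I,d)=\dim_K(S_d/I_d)$, and the sequence $\{H(S/I,d)\}_{d\ge 0}$ is the Hilbert function of $I$. *)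

theory Defs
  imports "HOL-Algebra.Embedded_Algebras" "HOL-Algebra.QuotRing" "HOL-Library.Poly_Mapping"
begin

text \<open>
  Monomials are exponent vectors of type \<open>nat \<Rightarrow>\<^sub>0 nat\<close>, and polynomials are finitely supported
  functions from monomials to the coefficient field; their type-class product is the usual
  (convolution) product of polynomials. The ring \<open>K[x\<^sub>1, \<dots>, x\<^sub>n]\<close> consists of those polynomials
  whose monomials only involve variables with an index in \<open>{1..n}\<close>.
\<close>

type_synonym 'k mpoly = "(nat \<Rightarrow>\<^sub>0 nat) \<Rightarrow>\<^sub>0 'k"

definition poly_ring :: "nat \<Rightarrow> 'k::field mpoly ring" where
  "poly_ring n = \<lparr>carrier = {p. \<forall>m \<in> Poly_Mapping.keys p. Poly_Mapping.keys m \<subseteq> {1..n}},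
                  mult = (*), one = 1, zero = 0, add = (+)\<rparr>"

definition var :: "nat \<Rightarrow> 'k::field mpoly" where
  "var i = Poly_Mapping.single (Poly_Mapping.single i 1) 1"

definition mon_deg :: "(nat \<Rightarrow>\<^sub>0 nat) \<Rightarrow> nat" where
  "mon_deg m = (\<Sum>i \<in> Poly_Mapping.keys m. Poly_Mapping.lookup m i)"

text \<open>
  The graded component \<open>S\<^sub>d\<close> of \<open>S = K[x\<^sub>1, \<dots>, x\<^sub>n]\<close>. It contains \<open>0\<close>; its nonzero elements are
  exactly the homogeneous polynomials of degree \<open>d\<close>.
\<close>

definition hom_component :: "nat \<Rightarrow> nat \<Rightarrow> 'k::field mpoly set" where
  "hom_component n d =
     {p \<in> carrier (poly_ring n). \<forall>m \<in> Poly_Mapping.keys p. mon_deg m = d}"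

definition monomials :: "nat \<Rightarrow> 'k::field mpoly set" where
  "monomials n = {Poly_Mapping.single m 1 | m. Poly_Mapping.keys m \<subseteq> {1..n}}"

definition graded_ideal :: "nat \<Rightarrow> 'k::field mpoly set \<Rightarrow> bool" where
  "graded_ideal n I \<longleftrightarrow>
     ideal I (poly_ring n) \<and> I \<noteq> carrier (poly_ring n) \<and>
     (\<exists>G \<subseteq> (\<Union>d. hom_component n d). I = genideal (poly_ring n) G)"

definition monomial_ideal :: "nat \<Rightarrow> 'k::field mpoly set \<Rightarrow> bool" where
  "monomial_ideal n I \<longleftrightarrow>
     graded_ideal n I \<and> (\<exists>G \<subseteq> monomials n. I = genideal (poly_ring n) G)"

text \<open>
  A sequence \<open>f 1, \<dots>, f t\<close> in a commutative ring \<open>R\<close> is regular if every \<open>f i\<close> is a nonzerodivisor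
  modulo the ideal generated by the preceding elements, and all of them together generate a
  proper ideal.
\<close>

definition regular_sequence :: "('a, 'b) ring_scheme \<Rightarrow> nat \<Rightarrow> (nat \<Rightarrow> 'a) \<Rightarrow> bool" where
  "regular_sequence R t f \<longleftrightarrow>
     f ` {1..t} \<subseteq> carrier R \<and>
     (\<forall>i \<in> {1..t}. \<forall>g \<in> carrier R.
        f i \<otimes>\<^bsub>R\<^esub> g \<in> genideal R (f ` {1..<i}) \<longrightarrow> g \<in> genideal R (f ` {1..<i})) \<and>
     genideal R (f ` {1..t}) \<noteq> carrier R"

text \<open>
  \<open>S\<^sub>d / I\<^sub>d\<close> is realised as the image of \<open>S\<^sub>d\<close> in \<open>S / I\<close> (the kernel of \<open>S\<^sub>d \<rightarrow> S / I\<close> is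
  \<open>I \<inter> S\<^sub>d = I\<^sub>d\<close>), and its \<open>K\<close>-dimension is taken over the copy of \<open>K\<close> in \<open>S / I\<close> formed by the
  classes of the constants.
\<close>

definition quot_scalars :: "nat \<Rightarrow> 'k::field mpoly set \<Rightarrow> 'k mpoly set set" where
  "quot_scalars n I = {I +>\<^bsub>poly_ring n\<^esub> Poly_Mapping.single 0 c | c. True}"

definition quot_component :: "nat \<Rightarrow> 'k::field mpoly set \<Rightarrow> nat \<Rightarrow> 'k mpoly set set" where
  "quot_component n I d = {I +>\<^bsub>poly_ring n\<^esub> p | p. p \<in> hom_component n d}"

definition hilbert_function :: "nat \<Rightarrow> 'k::field mpoly set \<Rightarrow> nat \<Rightarrow> nat" where
  "hilbert_function n I d =
     ring.dim (poly_ring n Quot I) (quot_scalars n I) (quot_component n I d)"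

lemma poly_ring_simps:
  "mult (poly_ring n) = (*)" "one (poly_ring n) = 1"
  "zero (poly_ring n) = 0" "add (poly_ring n) = (+)"
  by (simp_all add: poly_ring_def)

lemma cring_poly_ring: "cring (poly_ring n :: 'k::field mpoly ring)"
proof (rule cringI)
  let ?S = "poly_ring n :: 'k mpoly ring"
  have add: "p + q \<in> carrier ?S" if "p \<in> carrier ?S" "q \<in> carrier ?S" for p q
    using that Poly_Mapping.keys_add[of p q] unfolding poly_ring_def partial_object.simps by blast
  have mult: "p * q \<in> carrier ?S" if "p \<in> carrier ?S" "q \<in> carrier ?S" for p q
  proof -
    have "Poly_Mapping.keys m \<subseteq> {1..n}" if m: "m \<in> Poly_Mapping.keys (p * q)" for m
    proof -
      obtain a b where ab: "m = a + b" "a \<in> Poly_Mapping.keys p" "b \<in> Poly_Mapping.keys q"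
        using m Poly_Mapping.keys_mult[of p q] by blast
      then have "Poly_Mapping.keys a \<subseteq> {1..n}" "Poly_Mapping.keys b \<subseteq> {1..n}"
        using \<open>p \<in> carrier ?S\<close> \<open>q \<in> carrier ?S\<close> by (auto simp: poly_ring_def)
      then show ?thesis using ab(1) Poly_Mapping.keys_add[of a b] by blast
    qed
    then show ?thesis by (simp add: poly_ring_def)
  qed
  have one: "0 \<in> carrier ?S" "1 \<in> carrier ?S" by (simp_all add: poly_ring_def)
  show "abelian_group ?S"
  proof (rule abelian_groupI)
    fix p assume p: "p \<in> carrier ?S"
    show "\<exists>q \<in> carrier ?S. q \<oplus>\<^bsub>?S\<^esub> p = \<zero>\<^bsub>?S\<^esub>"
      using p by (intro bexI[of _ "- p"]) (auto simp: poly_ring_def)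
  qed (simp_all add: poly_ring_simps add one ac_simps)
  show "Group.comm_monoid ?S"
    by (rule Group.comm_monoidI) (simp_all add: poly_ring_simps mult one ac_simps)
qed (simp add: poly_ring_simps distrib_right)

lemma subfield_constants:
  "subfield {Poly_Mapping.single 0 c | c. True} (poly_ring n :: 'k::field mpoly ring)"
proof -
  let ?S = "poly_ring n :: 'k mpoly ring"
  let ?K = "{Poly_Mapping.single 0 c | c. True} :: 'k mpoly set"
  interpret S: cring ?S by (rule cring_poly_ring)
  have sub: "?K \<subseteq> carrier ?S" by (auto simp: poly_ring_def split: if_splits)
  have neg: "\<ominus>\<^bsub>?S\<^esub> Poly_Mapping.single 0 c = Poly_Mapping.single 0 (- c)" for c
  proof (rule S.minus_equality)
    show "Poly_Mapping.single 0 (- c) \<oplus>\<^bsub>?S\<^esub> Poly_Mapping.single 0 c = \<zero>\<^bsub>?S\<^esub>"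
      by (simp only: poly_ring_simps single_add[symmetric] left_minus single_zero)
  qed (use sub in auto)
  have "subcring ?K ?S"
  proof (rule S.subcringI', rule S.subringI)
    show "\<one>\<^bsub>?S\<^esub> \<in> ?K" by (simp add: poly_ring_simps) (metis single_one)
    show "\<ominus>\<^bsub>?S\<^esub> h \<in> ?K" if "h \<in> ?K" for h using that by (auto simp: neg)
    show "h1 \<otimes>\<^bsub>?S\<^esub> h2 \<in> ?K" if "h1 \<in> ?K" "h2 \<in> ?K" for h1 h2
      using that by (simp only: poly_ring_simps) (smt (verit) mem_Collect_eq mult_single add_0)
    show "h1 \<oplus>\<^bsub>?S\<^esub> h2 \<in> ?K" if "h1 \<in> ?K" "h2 \<in> ?K" for h1 h2
      using that by (simp only: poly_ring_simps) (smt (verit) mem_Collect_eq single_add)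
  qed (rule sub)
  moreover have "Units (?S\<lparr>carrier := ?K\<rparr>) = ?K - {\<zero>\<^bsub>?S\<^esub>}"
  proof (intro equalityI subsetI)
    fix u assume "u \<in> Units (?S\<lparr>carrier := ?K\<rparr>)"
    then obtain v where "u \<in> ?K" "v * u = 1"
      unfolding Units_def poly_ring_def partial_object.simps monoid.simps by blast
    moreover from this(2) have "u \<noteq> 0" by (metis mult_zero_right zero_neq_one)
    ultimately show "u \<in> ?K - {\<zero>\<^bsub>?S\<^esub>}"
      unfolding poly_ring_simps by blast
  next
    fix u assume u: "u \<in> ?K - {\<zero>\<^bsub>?S\<^esub>}"
    then obtain c where c: "u = Poly_Mapping.single 0 c" by blast
    let ?v = "Poly_Mapping.single 0 (inverse c) :: 'k mpoly"
    have "u \<noteq> 0" using u unfolding poly_ring_simps by blast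
    then have "c \<noteq> 0" using c by auto
    then have "u * ?v = 1" "?v * u = 1"
      unfolding c mult_single by simp_all
    moreover have "u \<in> ?K" "?v \<in> ?K" using c by blast+
    ultimately show "u \<in> Units (?S\<lparr>carrier := ?K\<rparr>)"
      unfolding Units_def poly_ring_def partial_object.simps monoid.simps by simp blast
  qed
  ultimately show ?thesis by (rule S.subfieldI)
qed

text \<open>For a proper ideal \<open>I\<close>, \<open>ring.dim\<close> above is indeed taken over a subfield of \<open>S / I\<close>.\<close>

lemma subfield_quot_scalars:
  fixes I :: "'k::field mpoly set"
  assumes "ideal I (poly_ring n)" and "I \<noteq> carrier (poly_ring n)"
  shows "subfield (quot_scalars n I) (poly_ring n Quot I)"
proof -
  let ?S = "poly_ring n :: 'k mpoly ring"
  let ?h = "\<lambda>p. I +>\<^bsub>?S\<^esub> p"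
  interpret I: ideal I ?S by (rule assms(1))
  have "\<one>\<^bsub>?S Quot I\<^esub> \<noteq> \<zero>\<^bsub>?S Quot I\<^esub>"
  proof
    assume "\<one>\<^bsub>?S Quot I\<^esub> = \<zero>\<^bsub>?S Quot I\<^esub>"
    then have "?h \<one>\<^bsub>?S\<^esub> = I" by (simp only: FactRing_def monoid.simps ring.simps)
    moreover have "\<one>\<^bsub>?S\<^esub> \<in> ?h \<one>\<^bsub>?S\<^esub>" by (rule I.a_rcos_self[OF I.one_closed])
    ultimately have "\<one>\<^bsub>?S\<^esub> \<in> I" by (rule subst)
    then show False using I.one_imp_carrier assms(2) by blast
  qed
  from ring_hom_ring.img_is_subfield(2)[OF I.rcos_ring_hom_ring subfield_constants this]
  have "subfield (?h ` {Poly_Mapping.single 0 c | c. True}) (?S Quot I)" .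
  moreover have "?h ` {Poly_Mapping.single 0 c | c. True} = quot_scalars n I"
    unfolding quot_scalars_def by blast
  ultimately show ?thesis by (rule subst[rotated])
qed

end

theory Submission
  imports Defs "HOL-Library.List_Lexorder" "HOL-Library.Multiset"
begin

text \<open>
  Passing to the monomials outside an ideal, the Hilbert function of a monomial ideal just counts
  the elements of a down-closed set \<open>D\<close> of monomials by degree. The regular sequence enters only
  through the following consequence: for a set \<open>F\<close> of fewer than \<open>i\<close> variables, \<open>M\<close> contains a
  monomial of degree at most \<open>a\<^sub>i\<close> that avoids \<open>F\<close>. Otherwise \<open>f\<^sub>1, \<dots>, f\<^sub>i\<close> lie in the prime ideal
  generated by \<open>F\<close>, and the products of powers of the \<open>f\<^sub>j\<close> with the monomials outside \<open>F\<close> are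
  linearly independent, which is impossible as there are too many of them.

  This property controls the growth of \<open>D\<close> by induction on the number of variables. Write a monomial
  \<open>x\<^sub>0 \<cdots> x\<^sub>s\<^sub>-\<^sub>1\<close> of \<open>M\<close>, with \<open>s = a\<^sub>1\<close>, as a product of variables and split \<open>D\<close> into the layers
  \<open>(D : x\<^sub>0 \<cdots> x\<^sub>j\<^sub>-\<^sub>1) / x\<^sub>j\<close>. These live in one variable less and have the same property for
  \<open>a\<^sub>2, \<dots>\<close>. If in a fixed degree the factors are ordered greedily, then the layers can be
  replaced by lexicographic segments in the box of exponent vectors bounded by \<open>a\<^sub>2, \<dots>\<close>, and
  these glue to a set of exponent vectors in the box bounded by \<open>a\<^sub>1, a\<^sub>2, \<dots>\<close>. The
  Clements-Lindstroem theorem then shows that the lexicographic segments of that box with the sizes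
  of the graded pieces of \<open>D\<close> form a down-closed set; its complement spans the required ideal.
\<close>

section \<open>Boxes of exponent vectors and lexicographic segments\<close>

definition box :: "nat list \<Rightarrow> nat \<Rightarrow> nat list set" where
  "box as d = {m. list_all2 (<) m as \<and> sum_list m = d}"

primrec incr :: "nat list \<Rightarrow> nat list \<Rightarrow> bool" where
  "incr [] w \<longleftrightarrow> False"
| "incr (j # m) w \<longleftrightarrow> w = Suc j # m \<or> (\<exists>m'. incr m m' \<and> w = j # m')"

definition shadow :: "nat list set \<Rightarrow> nat list set" where
  "shadow A = {m. \<exists>m' \<in> A. incr m m'}"

text \<open>
  Segments are taken at the lexicographically small end: they stand for the monomials outside a
  lex-plus-powers ideal, so that shadows go down and never leave the box.
\<close>

definition initseg :: "'a::linorder set \<Rightarrow> 'a set \<Rightarrow> bool" where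
  "initseg B S \<longleftrightarrow> S \<subseteq> B \<and> (\<forall>x \<in> B. \<forall>y \<in> S. x < y \<longrightarrow> x \<in> S)"

definition seg :: "'a::linorder set \<Rightarrow> nat \<Rightarrow> 'a set" where
  "seg B c = set (take c (sorted_list_of_set B))"

section \<open>Initial segments of a finite linear order\<close>

lemma seg_0 [simp]: "seg B 0 = {}"
  by (simp add: seg_def)

lemma initseg_seg: "finite B \<Longrightarrow> initseg B (seg B c)"
proof -
  assume fin: "finite B"
  let ?xs = "sorted_list_of_set B"
  have sub: "seg B c \<subseteq> B"
    using set_take_subset[of c ?xs] fin by (simp add: seg_def)
  have "x \<in> seg B c" if "x \<in> B" "y \<in> seg B c" "x < y" for x y
  proof (rule ccontr)
    assume "x \<notin> seg B c"
    moreover have "x \<in> set (take c ?xs @ drop c ?xs)" using that(1) fin by simp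
    ultimately have "x \<in> set (drop c ?xs)" unfolding set_append seg_def by blast
    moreover have "sorted (take c ?xs @ drop c ?xs)" by simp
    ultimately have "y \<le> x"
      using that(2) unfolding sorted_append seg_def by blast
    then show False using that(3) by simp
  qed
  with sub show ?thesis by (auto simp: initseg_def)
qed

lemma seg_subset: "finite B \<Longrightarrow> seg B c \<subseteq> B"
  using initseg_seg[of B c] by (simp add: initseg_def)

lemma seg_down: "finite B \<Longrightarrow> y \<in> seg B c \<Longrightarrow> x \<in> B \<Longrightarrow> x < y \<Longrightarrow> x \<in> seg B c"
  using initseg_seg[of B c] unfolding initseg_def by blast

lemma card_seg: "c \<le> card B \<Longrightarrow> card (seg B c) = c"
  by (simp add: seg_def distinct_card)

lemma initseg_subset_or:
  assumes "initseg B S" "initseg B T" shows "S \<subseteq> T \<or> T \<subseteq> S"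
proof (rule ccontr)
  assume "\<not> ?thesis"
  then obtain x y where xy: "x \<in> S" "x \<notin> T" "y \<in> T" "y \<notin> S" by blast
  then have "x < y \<or> y < x" by (metis linorder_neqE)
  with xy assms show False unfolding initseg_def by blast
qed

lemma initseg_finite: "finite B \<Longrightarrow> initseg B S \<Longrightarrow> finite S"
  by (auto simp: initseg_def intro: finite_subset)

lemma initseg_card_le_subset:
  assumes "finite B" "initseg B S" "initseg B T" "card S \<le> card T" shows "S \<subseteq> T"
  using initseg_subset_or[OF assms(2,3)]
proof
  assume "T \<subseteq> S"
  then have "T = S" using card_seteq[OF initseg_finite[OF assms(1,2)]] assms(4) by blast
  then show ?thesis by simp
qed

lemma initseg_eq:
  assumes "finite B" "initseg B S" "initseg B T" "card S = card T" shows "S = T"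
  using initseg_card_le_subset[OF assms(1-3)] initseg_card_le_subset[OF assms(1,3,2)] assms(4)
  by simp

lemma initseg_eq_seg: "finite B \<Longrightarrow> initseg B S \<Longrightarrow> S = seg B (card S)"
proof -
  assume B: "finite B" "initseg B S"
  then have "card S \<le> card B" by (simp add: card_mono initseg_def)
  then show ?thesis using initseg_eq[OF B initseg_seg[OF B(1)]] by (simp add: card_seg)
qed

text \<open>Initial segments of one order are nested, so a union is the larger of the two. This
  turns the size of a shadow of stacked segments into a sum of maxima.\<close>

lemma initseg_card_Un:
  assumes "finite B" "initseg B S" "initseg B T" shows "card (S \<union> T) = max (card S) (card T)"
  using initseg_card_le_subset[OF assms] initseg_card_le_subset[OF assms(1,3,2)]
  by (cases "card S \<le> card T") (auto simp: Un_absorb1 Un_absorb2)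

text \<open>Every element of \<open>S - T\<close> lies below every element of \<open>T - S\<close>,
  since \<open>S\<close> is an initial segment. Any bijection between these two differences
  therefore raises \<open>g\<close> strictly.\<close>

lemma sum_initseg_less:
  fixes g :: "'a::linorder \<Rightarrow> nat"
  assumes "finite B" "initseg B S" "T \<subseteq> B" "card S = card T" "S \<noteq> T"
    and mono: "\<And>x y. x \<in> B \<Longrightarrow> y \<in> B \<Longrightarrow> x < y \<Longrightarrow> g x < g y"
  shows "sum g S < sum g T"
proof -
  have SB: "S \<subseteq> B" using assms(2) by (simp add: initseg_def)
  have fS: "finite S" and fT: "finite T" using assms(1,3) SB finite_subset by blast+
  have c: "card (S - T) = card (T - S)"
    using card_Diff_subset_Int[of S T] card_Diff_subset_Int[of T S] fS fT assms(4)
    by (simp add: Int_commute)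
  then obtain h where h: "bij_betw h (S - T) (T - S)"
    using finite_same_card_bij[of "S - T" "T - S"] fS fT by auto
  have ne: "S - T \<noteq> {}"
  proof
    assume "S - T = {}"
    then have "card (T - S) = 0" using c by (metis card.empty)
    then have "T - S = {}" using fT by (metis card_0_eq finite_Diff)
    with \<open>S - T = {}\<close> assms(5) show False by blast
  qed
  have less: "g x < g (h x)" if x: "x \<in> S - T" for x
  proof -
    have hx: "h x \<in> T - S" using h x by (auto simp: bij_betw_def)
    have "\<not> h x < x" using x hx assms(2,3) unfolding initseg_def by blast
    moreover have "x \<noteq> h x" using x hx by auto
    ultimately have "x < h x" by simp
    then show ?thesis using mono x hx SB assms(3) by blast
  qed
  have "sum g (S - T) < (\<Sum>x \<in> S - T. g (h x))"
    using less ne fS by (intro sum_strict_mono) auto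
  also have "\<dots> = sum g (T - S)" by (rule sum.reindex_bij_betw[OF h])
  finally show ?thesis
    using sum.Int_Diff[OF fS, of g T] sum.Int_Diff[OF fT, of g S] by (simp add: Int_commute)
qed

section \<open>Boxes, raising one entry, and shadows\<close>

lemma finite_box: "finite (box as d)"
proof (rule finite_subset)
  show "box as d \<subseteq> {m. set m \<subseteq> {..d} \<and> length m = length as}"
    using member_le_sum_list by (auto simp: box_def dest: list_all2_lengthD)
  show "finite {m. set m \<subseteq> {..d} \<and> length m = length as}"
    by (rule finite_lists_length_eq) simp
qed

lemma length_box: "m \<in> box as d \<Longrightarrow> length m = length as"
  by (auto simp: box_def dest: list_all2_lengthD)

lemma incr_less: "incr m m' \<Longrightarrow> m < m'"
  by (induction m arbitrary: m') auto

lemma incr_length: "incr m m' \<Longrightarrow> length m' = length m"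
  by (induction m arbitrary: m') auto

lemma incr_sum_list: "incr m m' \<Longrightarrow> sum_list m' = Suc (sum_list m)"
  by (induction m arbitrary: m') auto

lemma incr_list_all2: "incr m m' \<Longrightarrow> list_all2 (<) m' as \<Longrightarrow> list_all2 (<) m as"
  proof (induction m arbitrary: m' as)
  case (Cons j m)
  then show ?case by (fastforce simp: list_all2_Cons1)
qed simp

lemma incr_snoc: "incr (q @ [j]) w \<longleftrightarrow> w = q @ [Suc j] \<or> (\<exists>q'. incr q q' \<and> w = q' @ [j])"
  by (induction q arbitrary: w) auto

lemma incr_box: "incr m m' \<Longrightarrow> m' \<in> box as d \<Longrightarrow> m \<in> box as (d - 1) \<and> d \<noteq> 0"
  using incr_list_all2[of m m' as] incr_sum_list[of m m'] by (auto simp: box_def)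

lemma shadow_box: "A \<subseteq> box as d \<Longrightarrow> shadow A \<subseteq> box as (d - 1)"
  by (auto simp: shadow_def dest: incr_box[of _ _ as d])

lemma shadow_mono: "A \<subseteq> B \<Longrightarrow> shadow A \<subseteq> shadow B"
  by (auto simp: shadow_def)

lemma finite_shadow: "A \<subseteq> box as d \<Longrightarrow> finite (shadow A)"
  by (rule finite_subset[OF shadow_box finite_box])

lemma shadow_empty [simp]: "shadow {} = {}"
  by (simp add: shadow_def)

lemma incr_or_full: 
  "list_all2 (<) p as \<Longrightarrow> (\<exists>p'. incr p p' \<and> list_all2 (<) p' as) \<or> as = map Suc p"
proof (induction p as rule: list_all2_induct)
  case (Cons x xs y ys)
  then show ?case by (cases "Suc x < y") (auto simp: list_all2_Cons1)
qed simp

lemma pointwise_less_Suc_sum_list: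
  assumes "list_all2 (<) m (map Suc p)"
  shows "sum_list m \<le> sum_list p \<and> (sum_list m = sum_list p \<longrightarrow> m = p)"
  using assms
proof (induction p arbitrary: m)
  case (Cons x p)
  then obtain y q where m: "m = y # q" "y \<le> x" "list_all2 (<) q (map Suc p)"
    by (auto simp: list_all2_Cons2)
  then show ?case using Cons.IH[OF m(3)] by auto
qed simp

text \<open>This is what makes shadows of segments segments again. A raise of \<open>m\<close>
  within the common prefix is copied; otherwise \<open>p\<close> is raised behind the first entry
  where it differs from \<open>m\<close>, or at that entry if the rest of \<open>p\<close> is
  already the top corner of its box.\<close>

lemma incr_le:
  "list_all2 (<) p as \<Longrightarrow> list_all2 (<) m' as \<Longrightarrow> sum_list p = sum_list m \<Longrightarrow> p < m \<Longrightarrow> incr m m'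
    \<Longrightarrow> \<exists>p'. incr p p' \<and> list_all2 (<) p' as \<and> p' \<le> m'"
proof (induction p arbitrary: as m m')
  case Nil
  then show ?case by (cases m) auto
next
  case (Cons i p)
  obtain a bs where as: "as = a # bs" and ia: "i < a" and p: "list_all2 (<) p bs"
    using Cons.prems(1) by (auto simp: list_all2_Cons1)
  obtain j q where m: "m = j # q" using Cons.prems(5) by (cases m) auto
  obtain j' q' where m': "m' = j' # q'" and j'a: "j' < a" and q': "list_all2 (<) q' bs"
    using Cons.prems(2) as by (auto simp: list_all2_Cons2)
  consider "i = j" "p < q" "j' = Suc j" "q' = q" | "i = j" "p < q" "incr q q'" "j' = j" | "i < j"
    using Cons.prems(4,5) m m' by auto
  then show ?case
  proof cases
    case 1
    then show ?thesis using p as j'a m' by (intro exI[of _ "Suc i # p"]) auto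
  next
    case 2
    then obtain p' where "incr p p'" "list_all2 (<) p' bs" "p' \<le> q'"
      using Cons.IH[OF p q'] Cons.prems(3) m by auto
    then show ?thesis using 2 as ia m' by (intro exI[of _ "i # p'"]) auto
  next
    case 3
    have jj': "j \<le> j'" using Cons.prems(5) m m' by auto
    show ?thesis
    proof (cases "\<exists>p'. incr p p' \<and> list_all2 (<) p' bs")
      case True
      then obtain p' where "incr p p'" "list_all2 (<) p' bs" by blast
      then show ?thesis using 3 jj' as ia m' by (intro exI[of _ "i # p'"]) auto
    next
      case False
      then have bs: "bs = map Suc p" using incr_or_full[OF p] by blast
      have "sum_list m' = Suc (i + sum_list p)"
        using incr_sum_list[OF Cons.prems(5)] Cons.prems(3) by simp
      then have s: "j' + sum_list q' = Suc (i + sum_list p)" using m' by simp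
      \<comment> \<open>The tail \<open>p\<close> is the top corner of its box, so the degree of
        \<open>q'\<close> is at most that of \<open>p\<close>. Hence \<open>j'\<close> is at least
        \<open>Suc i\<close>, and equality leaves only \<open>q' = p\<close>.\<close>
      have "Suc i < j' \<or> Suc i = j' \<and> p = q'"
        using pointwise_less_Suc_sum_list[of q' p] q' bs s 3 jj' by auto
      then show ?thesis using 3 jj' as j'a m' p by (intro exI[of _ "Suc i # p"]) auto
    qed
  qed
qed

lemma initseg_shadow:
  assumes "initseg (box as d) S" shows "initseg (box as (d - 1)) (shadow S)"
proof -
  have S: "S \<subseteq> box as d" using assms by (simp add: initseg_def)
  have "p \<in> shadow S" if p: "p \<in> box as (d - 1)" and m: "m \<in> shadow S" and less: "p < m" for p m
  proof -
    obtain m' where m': "m' \<in> S" "incr m m'" using m by (auto simp: shadow_def)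
    have d: "d \<noteq> 0" "m \<in> box as (d - 1)" using incr_box[OF m'(2)] m'(1) S by auto
    obtain p' where p': "incr p p'" "list_all2 (<) p' as" "p' \<le> m'"
      using incr_le[of p as m' m] p d m' S less by (auto simp: box_def)
    have "p' \<in> box as d" using p' p d by (auto simp: box_def incr_sum_list)
    then have "p' \<in> S" using p'(3) m'(1) assms unfolding initseg_def
      by (metis order_le_less)
    then show ?thesis using p' by (auto simp: shadow_def)
  qed
  with shadow_box[OF S] show ?thesis by (auto simp: initseg_def)
qed

section \<open>Layers along one coordinate and compression\<close>

definition seg_optimal :: "nat list \<Rightarrow> bool" where
  "seg_optimal as \<longleftrightarrow>
     (\<forall>d A. A \<subseteq> box as d \<longrightarrow> card (shadow (seg (box as d) (card A))) \<le> card (shadow A))"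

text \<open>The map \<open>ins j p\<close> puts the entry \<open>j\<close> into \<open>p\<close> at
  a fixed place; \<open>b\<close> bounds that entry and \<open>as'\<close> bounds the others. This
  treats the first and the last coordinate at once, and the instance for the first one also glues
  layers in the growth argument.\<close>

locale layering =
  fixes ins :: "nat \<Rightarrow> nat list \<Rightarrow> nat list" and b :: nat and as as' :: "nat list"
  assumes ins_box: "ins j p \<in> box as d \<longleftrightarrow> j < b \<and> (\<exists>e. p \<in> box as' e \<and> j + e = d)"
    and box_ins: "m \<in> box as d \<Longrightarrow> \<exists>j p. m = ins j p"
    and ins_inject: "ins j p = ins k q \<longleftrightarrow> j = k \<and> p = q"
    and ins_less: "length p = length q \<Longrightarrow> ins j p < ins j q \<longleftrightarrow> p < q"
    and incr_ins: "incr (ins j p) w \<longleftrightarrow> w = ins (Suc j) p \<or> (\<exists>p'. incr p p' \<and> w = ins j p')"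
begin

definition layer :: "nat list set \<Rightarrow> nat \<Rightarrow> nat list set" where
  "layer A j = {p. ins j p \<in> A}"

definition glue :: "(nat \<Rightarrow> nat list set) \<Rightarrow> nat list set" where
  "glue S = {ins j p | j p. p \<in> S j}"

lemma layer_glue [simp]: "layer (glue S) j = S j"
  by (auto simp: layer_def glue_def ins_inject)

lemma glue_layer:
  assumes "A \<subseteq> box as d" shows "glue (layer A) = A"
proof
  show "A \<subseteq> glue (layer A)"
  proof
    fix m assume "m \<in> A"
    moreover from this obtain j p where "m = ins j p" using box_ins assms by blast
    ultimately show "m \<in> glue (layer A)" by (auto simp: layer_def glue_def)
  qed
qed (auto simp: layer_def glue_def)

lemma layer_box:
  assumes "A \<subseteq> box as d" shows "layer A j \<subseteq> box as' (d - j)"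
    and "j \<ge> b \<or> j > d \<Longrightarrow> layer A j = {}"
proof -
  have "p \<in> box as' (d - j) \<and> j < b \<and> j \<le> d" if "p \<in> layer A j" for p
  proof -
    have "ins j p \<in> box as d" using that assms by (auto simp: layer_def)
    then show ?thesis by (auto simp: ins_box)
  qed
  then show "layer A j \<subseteq> box as' (d - j)" "j \<ge> b \<or> j > d \<Longrightarrow> layer A j = {}"
    by (blast, fastforce)
qed

lemma sum_layers:
  fixes g :: "nat list \<Rightarrow> nat"
  assumes "A \<subseteq> box as d"
  shows "sum g A = (\<Sum>j<b. \<Sum>p \<in> layer A j. g (ins j p))"
proof -
  have "A = (\<Union>j<b. ins j ` layer A j)"
  proof
    show "A \<subseteq> (\<Union>j<b. ins j ` layer A j)"
    proof
      fix m assume m: "m \<in> A"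
      then obtain j p where "m = ins j p" using box_ins assms by blast
      moreover from this m assms have "j < b" using ins_box by blast
      ultimately show "m \<in> (\<Union>j<b. ins j ` layer A j)"
        using m by (auto simp: layer_def)
    qed
  qed (auto simp: layer_def)
  then have "sum g A = sum g (\<Union>j<b. ins j ` layer A j)" by simp
  moreover have "finite (layer A j)" for j
    by (rule finite_subset[OF layer_box(1)[OF assms] finite_box])
  then have "sum g (\<Union>j<b. ins j ` layer A j) = (\<Sum>j<b. sum g (ins j ` layer A j))"
    by (intro sum.UNION_disjoint) (auto simp: ins_inject)
  moreover have "\<dots> = (\<Sum>j<b. \<Sum>p \<in> layer A j. g (ins j p))"
    by (simp add: sum.reindex inj_on_def ins_inject)
  ultimately show ?thesis by simp
qed

lemma card_layers: "A \<subseteq> box as d \<Longrightarrow> card A = (\<Sum>j<b. card (layer A j))"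
  using sum_layers[of A d "\<lambda>_. 1"] by simp

lemma layer_shadow: "layer (shadow A) j = shadow (layer A j) \<union> layer A (Suc j)"
  by (auto simp: layer_def shadow_def incr_ins)

lemma card_shadow_layers:
  "A \<subseteq> box as d \<Longrightarrow>
    card (shadow A) = (\<Sum>j<b. card (shadow (layer A j) \<union> layer A (Suc j)))"
  using card_layers[OF shadow_box] by (simp add: layer_shadow)

text \<open>The sizes \<open>c j\<close> are left open because they come from two sources: the
  layers of a set of vectors for compression, and layers of monomials for growth.\<close>

definition segs :: "nat \<Rightarrow> (nat \<Rightarrow> nat) \<Rightarrow> nat list set" where
  "segs d c = glue (\<lambda>j. seg (box as' (d - j)) (c j))"

lemma layer_segs: "layer (segs d c) j = seg (box as' (d - j)) (c j)"
  by (simp add: segs_def)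

context
  fixes d :: nat and c :: "nat \<Rightarrow> nat"
  assumes c_le: "\<And>j. c j \<le> card (box as' (d - j))"
    and c_0: "\<And>j. j \<ge> b \<or> j > d \<Longrightarrow> c j = 0"
begin

lemma segs_box: "segs d c \<subseteq> box as d"
proof
  fix m assume "m \<in> segs d c"
  then obtain j p where m: "m = ins j p" and p: "p \<in> seg (box as' (d - j)) (c j)"
    by (auto simp: segs_def glue_def)
  then have "c j \<noteq> 0" by (intro notI) simp
  then have j: "j < b" "j \<le> d" using c_0[of j] by linarith+
  have "p \<in> box as' (d - j)"
    using p seg_subset[OF finite_box] by blast
  with j show "m \<in> box as d" by (auto simp: m ins_box)
qed

lemma card_segs: "card (segs d c) = (\<Sum>j<b. c j)"
  by (simp add: card_layers[OF segs_box] layer_segs card_seg c_le)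

text \<open>In layer \<open>j\<close>, the shadow of the segment there and the segment of layer
  \<open>Suc j\<close> are both initial segments of \<open>box as' (d - Suc j)\<close>, so their
  union has the larger of the two sizes.\<close>

lemma card_shadow_segs:
  "card (shadow (segs d c)) = (\<Sum>j<b. max (card (shadow (seg (box as' (d - j)) (c j)))) (c (Suc j)))"
proof -
  have "card (shadow (seg (box as' (d - j)) (c j)) \<union> seg (box as' (d - Suc j)) (c (Suc j))) =
        max (card (shadow (seg (box as' (d - j)) (c j)))) (c (Suc j))" for j
    using initseg_card_Un[OF finite_box initseg_shadow initseg_seg, OF initseg_seg,
        OF finite_box finite_box, of as' "d - j" "c j" "c (Suc j)"]
    by (simp add: card_seg c_le)
  then show ?thesis by (simp add: card_shadow_layers[OF segs_box] layer_segs)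
qed

end

definition compress :: "nat \<Rightarrow> nat list set \<Rightarrow> nat list set" where
  "compress d A = segs d (\<lambda>j. card (layer A j))"

text \<open>Each layer of the new shadow has as its size a maximum of two numbers. Both are at most
  the size of the corresponding union for \<open>A\<close>: one by optimality in one coordinate
  less, the other by inclusion.\<close>

lemma compress:
  assumes opt: "seg_optimal as'" and A: "A \<subseteq> box as d"
  shows "compress d A \<subseteq> box as d" "card (compress d A) = card A"
    "card (shadow (compress d A)) \<le> card (shadow A)"
proof -
  let ?c = "\<lambda>j. card (layer A j)"
  have c_le: "?c j \<le> card (box as' (d - j))" for j
    by (rule card_mono[OF finite_box layer_box(1)[OF A]])
  have c_0: "j \<ge> b \<or> j > d \<Longrightarrow> ?c j = 0" for j
    using layer_box(2)[OF A] by simp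
  note segs = segs_box[of ?c d] card_segs[of ?c d] card_shadow_segs[of ?c d]
  show "compress d A \<subseteq> box as d" "card (compress d A) = card A"
    unfolding compress_def using segs(1,2) c_le c_0 card_layers[OF A] by auto
  have "max (card (shadow (seg (box as' (d - j)) (?c j)))) (?c (Suc j))
      \<le> card (shadow (layer A j) \<union> layer A (Suc j))" for j
  proof -
    have fin: "finite (shadow (layer A j) \<union> layer A (Suc j))"
      using finite_shadow[OF layer_box(1)[OF A]] finite_subset[OF layer_box(1)[OF A] finite_box]
      by blast
    have "card (shadow (seg (box as' (d - j)) (?c j))) \<le> card (shadow (layer A j))"
      using opt layer_box(1)[OF A] by (auto simp: seg_optimal_def)
    also have "\<dots> \<le> card (shadow (layer A j) \<union> layer A (Suc j))"
      by (rule card_mono[OF fin]) blast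
    finally show ?thesis using card_mono[OF fin, of "layer A (Suc j)"] by simp
  qed
  then show "card (shadow (compress d A)) \<le> card (shadow A)"
    using segs(3)[OF c_le c_0] card_shadow_layers[OF A] by (simp add: compress_def sum_mono)
qed

lemma layer_compress: "layer (compress d A) j = seg (box as' (d - j)) (card (layer A j))"
  unfolding compress_def segs_def by simp

text \<open>Each layer that changes is replaced by an initial segment of equal size, which lowers
  the sum of \<open>g\<close> over it. A set of least total rank is therefore fixed by
  compression.\<close>

lemma compress_decreases:
  fixes g :: "nat list \<Rightarrow> nat"
  assumes opt: "seg_optimal as'" and A: "A \<subseteq> box as d" and ne: "compress d A \<noteq> A"
    and mono: "\<And>x y. x \<in> box as d \<Longrightarrow> y \<in> box as d \<Longrightarrow> x < y \<Longrightarrow> g x < g y"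
  shows "sum g (compress d A) < sum g A"
proof -
  let ?S = "\<lambda>j. seg (box as' (d - j)) (card (layer A j))"
  let ?G = "\<lambda>j X. \<Sum>p \<in> X. g (ins j p)"
  have less: "?G j (?S j) < ?G j (layer A j)" if j: "?S j \<noteq> layer A j" for j
  proof (rule sum_initseg_less[OF finite_box initseg_seg[OF finite_box] layer_box(1)[OF A] _ j])
    show "card (?S j) = card (layer A j)"
      by (intro card_seg card_mono finite_box layer_box(1)[OF A])
    have "layer A j \<noteq> {}" using j by auto
    then have jb: "j < b \<and> j \<le> d" using layer_box(2)[OF A, of j] by linarith
    fix x y assume "x \<in> box as' (d - j)" "y \<in> box as' (d - j)" "x < y"
    with jb show "g (ins j x) < g (ins j y)"
      by (intro mono) (auto simp: ins_box ins_less length_box)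
  qed
  then have le: "?G j (?S j) \<le> ?G j (layer A j)" for j
    by (cases "?S j = layer A j") (auto intro: less_imp_le)
  obtain j where j: "?S j \<noteq> layer A j"
  proof (cases "\<forall>j. ?S j = layer A j")
    case True
    then have "compress d A = glue (layer A)" unfolding compress_def segs_def by simp
    with ne glue_layer[OF A] show ?thesis by simp
  qed blast
  then have "layer A j \<noteq> {}" by auto
  then have "j < b" using layer_box(2)[OF A, of j] by linarith
  then have "(\<Sum>j<b. ?G j (?S j)) < (\<Sum>j<b. ?G j (layer A j))"
    using le less[OF j] by (intro sum_strict_mono_ex1) auto
  then show ?thesis
    using sum_layers[OF A, of g] sum_layers[OF compress(1)[OF opt A], of g]
    by (simp add: layer_compress)
qed

text \<open>The layers of a fixed set are segments. The exchange argument uses compression in this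
  form: one may descend as long as one coordinate is kept.\<close>

lemma compressD:
  assumes "compress d A = A" "ins j p \<in> box as d" "ins j q \<in> A" "length p = length q"
    "ins j p < ins j q"
  shows "ins j p \<in> A"
proof -
  have "q \<in> seg (box as' (d - j)) (card (layer A j))"
    using assms(1,3) layer_compress[of d A j] by (simp add: layer_def)
  moreover have "p \<in> box as' (d - j)" "p < q"
    using assms(2,4,5) by (auto simp: ins_box ins_less)
  ultimately have "p \<in> seg (box as' (d - j)) (card (layer A j))"
    using seg_down[OF finite_box] by blast
  then show ?thesis using assms(1) layer_compress[of d A j] by (simp add: layer_def)
qed

end

lemma layering_Cons: "layering (#) a (a # as) as"
proof
  show "m \<in> box (a # as) d \<Longrightarrow> \<exists>j p. m = j # p" for m d
    by (auto simp: box_def list_all2_Cons2)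
qed (auto simp: box_def)

lemma append_less_append_iff:
  fixes p q :: "nat list"
  shows "length p = length q \<Longrightarrow> p @ r < q @ r \<longleftrightarrow> p < q"
  by (induction p q rule: list_induct2) auto

lemma list_all2_snoc_iff: "list_all2 P (p @ [j]) (as @ [a]) \<longleftrightarrow> list_all2 P p as \<and> P j a"
  by (simp add: list_all2_conv_all_nth nth_append less_Suc_eq all_conj_distrib) auto

lemma layering_snoc: "layering (\<lambda>j p. p @ [j]) a (as @ [a]) as"
proof
  show "\<exists>j p. m = p @ [j]" if "m \<in> box (as @ [a]) d" for m d
    using that by (cases m rule: rev_cases) (auto simp: box_def)
qed (auto simp: box_def append_less_append_iff incr_snoc list_all2_snoc_iff)

section \<open>The Clements-Lindstroem theorem\<close>

lemma seg_card_self: "finite B \<Longrightarrow> seg B (card B) = B"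
  using initseg_eq_seg[of B B] by (simp add: initseg_def)

section \<open>The Clements-Lindstroem theorem in at most two coordinates\<close>

lemma seg_optimal_le_1:
  assumes "length as \<le> 1" shows "seg_optimal as"
proof -
  have "\<exists>x. box as d \<subseteq> {x}" for d
    using assms by (cases as) (auto simp: box_def list_all2_Cons2)
  have "A = {} \<or> A = box as d" if A: "A \<subseteq> box as d" for A d
  proof -
    obtain x where "box as d \<subseteq> {x}" using \<open>\<And>d. \<exists>x. box as d \<subseteq> {x}\<close> by blast
    with A show ?thesis by blast
  qed
  then have "card (shadow (seg (box as d) (card A))) \<le> card (shadow A)" if "A \<subseteq> box as d" for A d
    using that[THEN \<open>\<And>A d. A \<subseteq> box as d \<Longrightarrow> A = {} \<or> A = box as d\<close>]
    by (auto simp: seg_card_self finite_box)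
  then show ?thesis by (simp add: seg_optimal_def)
qed

lemma mem_box_2: "m \<in> box [a, b] d \<longleftrightarrow> (\<exists>i j. m = [i, j] \<and> i < a \<and> j < b \<and> i + j = d)"
  by (auto simp: box_def list_all2_Cons2)

text \<open>The box is a stretch of the diagonal \<open>i + j = d\<close>. If
  \<open>b \<le> d\<close>, the shadow of a nonempty set is larger than the set by at least one,
  that of a segment by at most one. Otherwise the shadow of a segment is no larger than the segment,
  and that of \<open>A\<close> can be smaller than \<open>A\<close> only if \<open>A\<close> is the
  whole diagonal.\<close>

lemma seg_optimal_2:
  assumes "a \<le> b" shows "seg_optimal [a, b]"
  unfolding seg_optimal_def
proof (intro allI impI)
  fix d A assume A: "A \<subseteq> box [a, b] d"
  let ?B = "box [a, b] d" and ?f = "\<lambda>m. [m ! 0, m ! 1 - 1] :: nat list"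
  define S where "S = seg ?B (card A)"
  have S: "S \<subseteq> ?B" "card S = card A"
    using seg_subset[OF finite_box] A by (auto simp: S_def card_seg card_mono finite_box)
  have down: "[i, j] \<in> S" if "[Suc i, j'] \<in> S" "j = Suc j'" "j < b" for i j j'
    using that(1) S(1) unfolding S_def
    by (rule_tac seg_down[OF finite_box, of "[Suc i, j']"]) (use that in \<open>auto simp: mem_box_2\<close>)
  have fin: "finite A" "finite S"
    using finite_subset[OF _ finite_box] A S(1) by auto
  have fin': "finite (shadow A)" by (rule finite_shadow[OF A])
  show "card (shadow S) \<le> card (shadow A)"
  proof (cases "A = {}")
    case True
    then show ?thesis by (simp add: S_def)
  next
    case ne: False
    show ?thesis
    proof (cases "b \<le> d")
      case True
      have pos: "\<exists>i j. m = [Suc i, Suc j]" if m: "m \<in> A" for m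
      proof -
        obtain i j where "m = [i, j]" "i < a" "j < b" "i + j = d"
          using subsetD[OF A m] unfolding mem_box_2 by blast
        then show ?thesis using assms True by (cases i; cases j) auto
      qed
      \<comment> \<open>What arises by lowering a first entry also arises by lowering the second
        entry of the next smaller vector. Only for second entry \<open>b - 1\<close> does that
        vector leave the box.\<close>
      have "shadow S \<subseteq> insert [d - b, b - 1] (?f ` S)"
      proof
        fix m assume "m \<in> shadow S"
        then obtain m' where m': "m' \<in> S" "incr m m'" by (auto simp: shadow_def)
        then obtain i j where ij: "m' = [i, j]" "i < a" "j < b" "i + j = d"
          using subsetD[OF S(1)] unfolding mem_box_2 by blast
        then obtain k l where kl: "m = [k, l]"
          using incr_length[OF m'(2)] by (auto simp: length_Suc_conv Suc_length_conv)
        consider "m' = [Suc k, l]" | "m' = [k, Suc l]" using m'(2) kl by auto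
        then show "m \<in> insert [d - b, b - 1] (?f ` S)"
        proof cases
          case 1
          show ?thesis
          proof (cases "Suc l < b")
            case True
            then have "[k, Suc l] \<in> S" using down m'(1) 1 by blast
            then show ?thesis by (auto simp: kl image_iff intro!: bexI[of _ "[k, Suc l]"])
          next
            case False
            then show ?thesis using 1 ij kl by auto
          qed
        next
          case 2
          then show ?thesis using m'(1) by (auto simp: kl image_iff intro!: bexI[of _ "[k, Suc l]"])
        qed
      qed
      then have "card (shadow S) \<le> card (insert [d - b, b - 1] (?f ` S))"
        by (rule card_mono[rotated]) (simp add: fin)
      also have "\<dots> \<le> Suc (card S)"
        using card_image_le[OF fin(2), of ?f] card_insert_le_m1 by (simp add: card_insert_if fin)
      finally have 1: "card (shadow S) \<le> Suc (card A)" by (simp add: S)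
      \<comment> \<open>The member with least first entry yields the extra shadow element: lowering
        its first entry gives a vector that no lowering of a second entry produces.\<close>
      obtain m where m: "m \<in> A" "\<forall>m' \<in> A. hd m \<le> hd m'"
        using ex_has_least_nat[of "\<lambda>m. m \<in> A" _ hd] ne by blast
      obtain i j where ij: "m = [Suc i, Suc j]" using pos[OF m(1)] by blast
      have "inj_on ?f A" by (rule inj_onI) (auto dest!: pos)
      moreover have "[i, Suc j] \<notin> ?f ` A"
      proof
        assume "[i, Suc j] \<in> ?f ` A"
        then obtain m' where m': "m' \<in> A" "[i, Suc j] = ?f m'" by blast
        then have "hd m' = i" using pos[OF m'(1)] by auto
        then show False using m(2) m'(1) ij by auto
      qed
      moreover have "insert [i, Suc j] (?f ` A) \<subseteq> shadow A"
      proof -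
        have "?f m' \<in> shadow A" if "m' \<in> A" for m'
          using pos[OF that] that by (auto simp: shadow_def)
        moreover have "[i, Suc j] \<in> shadow A" using m(1) ij by (auto simp: shadow_def)
        ultimately show ?thesis by blast
      qed
      ultimately have "Suc (card A) \<le> card (shadow A)"
        using card_mono[OF fin', of "insert [i, Suc j] (?f ` A)"] fin by (simp add: card_image)
      with 1 show ?thesis by simp
    next
      case False
      show ?thesis
      proof (cases "\<exists>i \<le> d. [i, d - i] \<notin> A")
        case True
        then obtain k where k: "k \<le> d" "[k, d - k] \<notin> A" by blast
        have "shadow S \<subseteq> ?f ` S"
        proof
          fix m assume "m \<in> shadow S"
          then obtain m' where m': "m' \<in> S" "incr m m'" by (auto simp: shadow_def)
          then obtain i j where ij: "m' = [i, j]" "i < a" "j < b" "i + j = d"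
            using subsetD[OF S(1)] unfolding mem_box_2 by blast
          then obtain k l where kl: "m = [k, l]"
            using incr_length[OF m'(2)] by (auto simp: length_Suc_conv Suc_length_conv)
          then have "[k, Suc l] \<in> S" using m' down[of k l "Suc l"] ij False by auto
          then show "m \<in> ?f ` S" by (auto simp: kl image_iff intro!: bexI[of _ "[k, Suc l]"])
        qed
        then have 1: "card (shadow S) \<le> card A"
          using surj_card_le[OF fin(2)] S(2) by metis
        \<comment> \<open>The gap at \<open>k\<close> divides \<open>A\<close>. Lowering the second
          entry on its left and the first entry on its right keeps the images apart.\<close>
        let ?h = "\<lambda>m. if m ! 0 < k then [m ! 0, m ! 1 - 1] else [m ! 0 - 1, m ! 1]"
        have cases: "(\<exists>i j. m = [i, Suc j] \<and> i < k) \<or> (\<exists>i j. m = [Suc i, j] \<and> k \<le> i)"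
          if m: "m \<in> A" for m
        proof -
          obtain i j where ij: "m = [i, j]" "i < a" "j < b" "i + j = d"
            using subsetD[OF A m] unfolding mem_box_2 by blast
          then have "i \<noteq> k" using m k by auto
          then show ?thesis using ij k by (cases i; cases j) auto
        qed
        have "m = m'" if "m \<in> A" "m' \<in> A" "?h m = ?h m'" for m m'
          using cases[OF that(1)] cases[OF that(2)] that(3) by auto
        then have "inj_on ?h A" by (rule inj_onI)
        moreover have "?h m \<in> shadow A" if m: "m \<in> A" for m
          using cases[OF m]
        proof (elim disjE exE conjE)
          fix i j assume "m = [i, Suc j]" "i < k"
          then show ?thesis using m by (force simp: shadow_def)
        next
          fix i j assume "m = [Suc i, j]" "k \<le> i"
          then show ?thesis using m by (force simp: shadow_def)
        qed
        then have "?h ` A \<subseteq> shadow A" by blast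
        ultimately have "card A \<le> card (shadow A)"
          by (rule card_inj_on_le[OF _ _ fin'])
        with 1 show ?thesis by simp
      next
        case False
        have "?B \<subseteq> A"
        proof
          fix m assume "m \<in> ?B"
          then obtain i j where "m = [i, j]" "i + j = d" by (auto simp: mem_box_2)
          then have "i \<le> d" "m = [i, d - i]" by auto
          then show "m \<in> A" using False by blast
        qed
        then have "A = ?B" using A by blast
        then show ?thesis by (simp add: S_def seg_card_self finite_box)
      qed
    qed
  qed
qed

section \<open>The exchange argument in three or more coordinates\<close>

lemma append_less_append_of_less:
  "length p = length q \<Longrightarrow> p < q \<Longrightarrow> p @ r < q @ (r' :: nat list)"
  by (induction p q rule: list_induct2) auto

lemma zeros_le: "length m = k \<Longrightarrow> replicate k (0::nat) \<le> m"
proof (induction m arbitrary: k)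
  case (Cons x m)
  then show ?case by (cases k; cases x) auto
qed simp

lemma ex_pointwise_le_sum_list:
  "s \<le> sum_list m \<Longrightarrow> \<exists>m'. list_all2 (\<le>) m' m \<and> sum_list m' = (s :: nat)"
proof (induction m arbitrary: s)
  case (Cons x m)
  show ?case
  proof (cases "s \<le> x")
    case True
    have "list_all2 (\<le>) (replicate (length m) 0) m" by (simp add: list_all2_conv_all_nth)
    then show ?thesis using True
      by (intro exI[of _ "s # replicate (length m) 0"]) (auto simp: sum_list_replicate)
  next
    case False
    have "s - x \<le> sum_list m" using Cons.prems by simp
    then obtain m' where "list_all2 (\<le>) m' m" "sum_list m' = s - x"
      using Cons.IH by blast
    then show ?thesis using False by (intro exI[of _ "x # m'"]) auto
  qed
qed simp

lemma pointwise_le_imp_le: "list_all2 (\<le>) m' (m :: nat list) \<Longrightarrow> m' \<le> m"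
  by (induction rule: list_all2_induct) auto

lemma pointwise_le_less_trans:
  "list_all2 (\<le>) m' m \<Longrightarrow> list_all2 (<) m as \<Longrightarrow> list_all2 (<) m' (as :: nat list)"
  by (rule list_all2_trans[of "(\<le>)" "(<)" "(<)" m' m as]) auto

lemma mem_box_Cons_snoc:
  "m \<in> box (a # as @ [b]) d \<longleftrightarrow>
    (\<exists>x p y. m = x # p @ [y] \<and> x < a \<and> list_all2 (<) p as \<and> y < b \<and> x + sum_list p + y = d)"
proof
  assume m: "m \<in> box (a # as @ [b]) d"
  then obtain x q where q: "m = x # q" "x < a" "list_all2 (<) q (as @ [b])" "x + sum_list q = d"
    by (auto simp: box_def list_all2_Cons2)
  moreover from q(3) obtain p y where "q = p @ [y]" by (cases q rule: rev_cases) auto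
  ultimately show "\<exists>x p y. m = x # p @ [y] \<and> x < a \<and> list_all2 (<) p as \<and> y < b \<and>
      x + sum_list p + y = d"
    by (auto simp: list_all2_snoc_iff)
qed (auto simp: box_def list_all2_snoc_iff)

text \<open>
  If the last entry of \<open>z\<close> were not smaller than that of \<open>y\<close>, then one could descend from \<open>y\<close> to
  \<open>z\<close> inside the box through at most three intermediate vectors, each sharing its first or its last
  entry with the next one.
\<close>

lemma last_less_of_gap:
  assumes le: "a1 \<le> a2"
    and A: "A \<subseteq> box (a1 # (a2 # as) @ [an]) d"
    and hd: "\<And>i p q. i # q \<in> A \<Longrightarrow> i # p \<in> box (a1 # (a2 # as) @ [an]) d \<Longrightarrow> p < q \<Longrightarrow> i # p \<in> A"
    and last: "\<And>i p q. q @ [i] \<in> A \<Longrightarrow> p @ [i] \<in> box (a1 # (a2 # as) @ [an]) d \<Longrightarrow> p < q \<Longrightarrow> p @ [i] \<in> A"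
    and y: "y \<in> A" and z: "z \<in> box (a1 # (a2 # as) @ [an]) d" "z \<notin> A" and less: "z < y"
  shows "last z < last y"
proof (rule ccontr)
  let ?B = "box (a1 # (a2 # as) @ [an]) d"
  assume not_less: "\<not> last z < last y"
  obtain y1 ym yn where ys: "y = y1 # ym @ [yn]" "y1 < a1" "list_all2 (<) ym (a2 # as)" "yn < an"
    "y1 + sum_list ym + yn = d"
    using subsetD[OF A y] unfolding mem_box_Cons_snoc by blast
  obtain z1 zm zn where zs: "z = z1 # zm @ [zn]" "z1 < a1" "list_all2 (<) zm (a2 # as)"
    "zn < an" "z1 + sum_list zm + zn = d"
    using z(1) unfolding mem_box_Cons_snoc by blast
  have len: "length ym = length zm" using ys(3) zs(3) by (auto dest!: list_all2_lengthD)
  have "z1 \<noteq> y1"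
    using hd[of z1 "ym @ [yn]" "zm @ [zn]"] y z less ys(1) zs(1) by auto
  then have z1: "z1 < y1" using less ys(1) zs(1) by auto
  have "zn \<noteq> yn"
    using last[of "y1 # ym" yn "z1 # zm"] y z z1 ys(1) zs(1) by auto
  then have yn: "yn < zn" using not_less ys(1) zs(1) by simp
  show False
  proof (cases "zn \<le> sum_list ym + yn")
    case True
    \<comment> \<open>The middle of \<open>y\<close> is lowered so that the last entry can rise to
      \<open>zn\<close>. The result shares its first entry with \<open>y\<close> and its last entry
      with \<open>z\<close>.\<close>
    have "sum_list ym + yn - zn \<le> sum_list ym" using yn by simp
    then obtain m where m: "list_all2 (\<le>) m ym" "sum_list m = sum_list ym + yn - zn"
      using ex_pointwise_le_sum_list by blast
    have u: "y1 # m @ [zn] \<in> ?B"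
      using pointwise_le_less_trans[OF m(1) ys(3)] m(2) True ys zs
      unfolding mem_box_Cons_snoc by force
    have "sum_list m < sum_list ym" using m(2) True yn by linarith
    then have "m < ym" using pointwise_le_imp_le[OF m(1)] by (auto simp: order_le_less)
    moreover have "length m = length ym" using m(1) by (rule list_all2_lengthD)
    ultimately have "m @ [zn] < ym @ [yn]"
      using append_less_append_of_less by blast
    then have "y1 # m @ [zn] \<in> A" using hd[of y1 "ym @ [yn]"] u y ys(1) by simp
    then show False using last[of "y1 # m" zn "z1 # zm"] z z1 zs(1) by simp
  next
    case False
    \<comment> \<open>In this case the whole degree behind \<open>y1\<close> moves into the last
      entry, where it is still below \<open>zn\<close> and so within the bound.\<close>
    define s where "s = sum_list ym + yn"
    have s: "s < zn" "y1 + s = d" using False ys(5) by (auto simp: s_def)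
    obtain y2 ym' z2 zm' where m2: "ym = y2 # ym'" "y2 < a2" "list_all2 (<) ym' as"
        "zm = z2 # zm'" "z2 < a2"
      using ys(3) zs(3) by (auto simp: list_all2_Cons2)
    let ?k = "length as"
    have pos: "list_all2 (<) (replicate ?k 0) as"
      using m2(3) by (fastforce simp: list_all2_conv_all_nth)
    have "y1 # (0 # replicate ?k 0) @ [s] \<in> A"
    proof (cases "0 # replicate ?k 0 = ym")
      case True
      then have "s = yn" unfolding s_def by (auto simp: sum_list_replicate)
      then show ?thesis using y ys(1) True by simp
    next
      case neq: False
      have "replicate (length ym) 0 \<le> ym" by (rule zeros_le) simp
      moreover have "replicate (length ym) 0 = 0 # replicate ?k 0"
        using m2(1,3) by (auto dest: list_all2_lengthD)
      ultimately have "0 # replicate ?k 0 < ym" using neq by (metis order_le_less)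
      then have "(0 # replicate ?k 0) @ [s] < ym @ [yn]"
        using m2(1,3) by (intro append_less_append_of_less) (auto dest: list_all2_lengthD)
      moreover have "y1 # (0 # replicate ?k 0) @ [s] \<in> ?B"
        unfolding mem_box_Cons_snoc using ys(2) m2(2) pos s zs(4)
        by (intro exI[of _ y1] exI[of _ "0 # replicate ?k 0"] exI[of _ s])
          (auto simp: sum_list_replicate)
      ultimately show ?thesis using hd[of y1 "ym @ [yn]"] y ys(1) by simp
    qed
    \<comment> \<open>Lowering the first entry to \<open>z1\<close> moves \<open>y1 - z1\<close>
      into the second one. It fits there because \<open>y1 < a1\<close> and
      \<open>a1 \<le> a2\<close>: the order of the bounds enters here.\<close>
    moreover have w: "z1 # ((y1 - z1) # replicate ?k 0) @ [s] \<in> ?B"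
      unfolding mem_box_Cons_snoc using ys(2) le z1 zs(2,4) m2(2) pos s
      by (intro exI[of _ z1] exI[of _ "(y1 - z1) # replicate ?k 0"] exI[of _ s])
        (auto simp: sum_list_replicate)
    moreover have "z1 # (y1 - z1) # replicate ?k 0 < y1 # 0 # replicate ?k 0"
      using z1 by simp
    ultimately have "z1 # ((y1 - z1) # replicate ?k 0) @ [s] \<in> A"
      using last[of "y1 # 0 # replicate ?k 0" s "z1 # (y1 - z1) # replicate ?k 0"] by simp
    moreover have "z2 < y1 - z1" using s zs(5) m2(4) by simp
    ultimately show False
      using hd[of z1 "(y1 - z1) # replicate ?k 0 @ [s]" "zm @ [zn]"] z zs(1) m2(4) by simp
  qed
qed

text \<open>
  The exchange loses the element of the shadow obtained by lowering the last entry of \<open>y\<close>. It gains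
  at most the one obtained by lowering the last entry of \<open>z\<close>: after lowering another entry, raising
  the last one leads to an element below \<open>z\<close>.
\<close>

lemma exchange:
  assumes A: "A \<subseteq> box (as @ [an]) d" and y: "y \<in> A" "\<And>x. x \<in> A \<Longrightarrow> x \<le> y"
    and z: "z \<in> box (as @ [an]) d" "z \<notin> A" "\<And>x. x \<in> box (as @ [an]) d \<Longrightarrow> x < z \<Longrightarrow> x \<in> A"
    and less: "z < y" "last z < last y"
  shows "card (shadow (insert z (A - {y}))) \<le> card (shadow A)"
proof -
  obtain p j where p: "y = p @ [j]" "j < an"
    using subsetD[OF A y(1)] layering.box_ins[OF layering_snoc] layering.ins_box[OF layering_snoc]
    by metis
  obtain q k where q: "z = q @ [k]" "k < an"
    using z(1) layering.box_ins[OF layering_snoc] layering.ins_box[OF layering_snoc] by metis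
  have kj: "k < j" using less(2) p q by simp
  let ?A = "A - {y}" and ?y = "p @ [j - 1]" and ?z = "q @ [k - 1]"
  have "?y \<in> shadow A" using p(1) y(1) kj by (auto simp: shadow_def incr_snoc)
  \<comment> \<open>Any other way up from this vector raises an entry of \<open>p\<close> and so
    leads above \<open>y\<close>, the maximum of \<open>A\<close>.\<close>
  moreover have "?y \<notin> shadow ?A"
  proof
    assume "?y \<in> shadow ?A"
    then obtain p' where p': "incr p p'" "p' @ [j - 1] \<in> A"
      using p kj by (auto simp: shadow_def incr_snoc)
    then have "p @ [j] < p' @ [j - 1]"
      using incr_less incr_length by (metis append_less_append_of_less)
    then show False using y(2)[OF p'(2)] p(1) by simp
  qed
  moreover have fin: "finite (shadow A)" by (rule finite_shadow[OF A])
  moreover have sub: "shadow ?A \<subseteq> shadow A" by (rule shadow_mono) blast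
  ultimately have "card (shadow ?A) < card (shadow A)"
    by (intro psubset_card_mono) auto
  moreover have "shadow (insert z ?A) \<subseteq> insert ?z (shadow ?A)"
  proof
    fix m assume "m \<in> shadow (insert z ?A)"
    then consider "m \<in> shadow ?A" | "incr m z" by (auto simp: shadow_def)
    then show "m \<in> insert ?z (shadow ?A)"
    proof cases
      case 2
      obtain r l where m: "m = r @ [l]"
        using incr_length[OF 2] q(1) by (cases m rule: rev_cases) auto
      show ?thesis
      proof (cases "q = r")
        case True
        then show ?thesis using 2 m q by (auto simp: incr_snoc dest: incr_less)
      next
        case False
        then have r: "incr r q" "l = k" using 2 m q by (auto simp: incr_snoc)
        have "r @ [Suc k] < z"
          using q incr_less[OF r(1)] incr_length[OF r(1)] append_less_append_of_less by metis
        \<comment> \<open>The raised last entry respects its bound because \<open>k < j\<close> and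
          \<open>j < an\<close>; this is what the condition on the last entries is for.\<close>
        moreover have "r @ [Suc k] \<in> box (as @ [an]) d"
          using z(1) q p kj incr_list_all2[OF r(1)] incr_sum_list[OF r(1)]
          by (auto simp: box_def list_all2_snoc_iff)
        ultimately have "r @ [Suc k] \<in> ?A" using z(3) less(1) by auto
        then show ?thesis using m r by (auto simp: shadow_def incr_snoc)
      qed
    qed auto
  qed
  then have "card (shadow (insert z ?A)) \<le> card (insert ?z (shadow ?A))"
    using finite_subset[OF sub fin] by (intro card_mono) auto
  ultimately show ?thesis
    using finite_subset[OF sub fin] by (auto simp: card_insert_if split: if_splits)
qed

text \<open>The Clements-Lindstroem theorem. Among sets of the given size with no larger shadow, one
  of least total rank is fixed by compression along the first and the last coordinate. If it were
  not a segment, swapping its largest member for the smallest vector missing from it would lower the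
  rank.\<close>

theorem seg_optimal_sorted:
  "sorted as \<Longrightarrow> seg_optimal as"
proof (induction "length as" arbitrary: as rule: less_induct)
  case less
  consider "length as \<le> 1" | a b where "as = [a, b]" | a1 a2 bs an where "as = a1 # (a2 # bs) @ [an]"
    by (cases as; cases "tl as"; cases "tl (tl as)" rule: rev_cases) auto
  then show ?case
  proof cases
    case 1
    then show ?thesis by (rule seg_optimal_le_1)
  next
    case 2
    then show ?thesis using less.prems seg_optimal_2 by simp
  next
    case 3
    have opt: "seg_optimal ((a2 # bs) @ [an])" "seg_optimal (a1 # a2 # bs)"
      using less 3 by (auto simp: sorted_append)
    interpret hd: layering "(#)" a1 as "(a2 # bs) @ [an]"
      using layering_Cons 3 by simp
    interpret last: layering "\<lambda>j p. p @ [j]" an as "a1 # a2 # bs"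
      using layering_snoc[where as = "a1 # a2 # bs"] 3 by simp
    show ?thesis unfolding seg_optimal_def
    proof (intro allI impI)
      fix d A0 assume A0: "A0 \<subseteq> box as d"
      let ?B = "box as d"
      \<comment> \<open>A competitor of least total rank is stable under both compressions and admits no exchange.\<close>
      define rank where "rank m = card {p \<in> ?B. p < m}" for m
      have mono: "rank x < rank y" if "x \<in> ?B" "y \<in> ?B" "x < y" for x y
        unfolding rank_def using that finite_box[of as d] by (intro psubset_card_mono) auto
      define good where "good A \<longleftrightarrow> A \<subseteq> ?B \<and> card A = card A0 \<and> card (shadow A) \<le> card (shadow A0)"
        for A
      obtain A where good: "good A" and min: "\<And>A'. good A' \<Longrightarrow> sum rank A \<le> sum rank A'"
        using ex_has_least_nat[of good A0 "sum rank"] A0 by (auto simp: good_def)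
      then have A: "A \<subseteq> ?B" by (simp add: good_def)
      have fA: "finite A" using A finite_box finite_subset by blast
      have chd: "hd.compress d A = A"
      proof (rule ccontr)
        assume "hd.compress d A \<noteq> A"
        then have "sum rank (hd.compress d A) < sum rank A"
          by (rule hd.compress_decreases[OF opt(1) A _ mono])
        moreover have "good (hd.compress d A)"
          using hd.compress[OF opt(1) A] good by (simp add: good_def)
        ultimately show False using min by fastforce
      qed
      have clast: "last.compress d A = A"
      proof (rule ccontr)
        assume "last.compress d A \<noteq> A"
        then have "sum rank (last.compress d A) < sum rank A"
          by (rule last.compress_decreases[OF opt(2) A _ mono])
        moreover have "good (last.compress d A)"
          using last.compress[OF opt(2) A] good by (simp add: good_def)
        ultimately show False using min by fastforce
      qed
      have "initseg ?B A"
      proof (rule ccontr)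
        assume "\<not> initseg ?B A"
        then obtain z0 y0 where zy0: "z0 \<in> ?B" "z0 \<notin> A" "y0 \<in> A" "z0 < y0"
          using A by (auto simp: initseg_def)
        define y where "y = Max A"
        define z where "z = Min (?B - A)"
        have fB: "finite (?B - A)" using finite_box by blast
        have y: "y \<in> A" "\<And>x. x \<in> A \<Longrightarrow> x \<le> y"
          unfolding y_def using fA zy0 by (auto intro: Max_in)
        have z: "z \<in> ?B - A" "\<And>x. x \<in> ?B - A \<Longrightarrow> z \<le> x"
          unfolding z_def using fB zy0 Min_in[of "?B - A"] by auto
        have zy: "z < y" using y(2)[of y0] z(2)[of z0] zy0 by auto
        have "last z < last y"
        proof (rule last_less_of_gap)
          show "a1 \<le> a2" using less.prems 3 by simp
          show "A \<subseteq> box (a1 # (a2 # bs) @ [an]) d" using A 3 by simp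
          fix i p q
          show "i # p \<in> A" if "i # q \<in> A" "i # p \<in> box (a1 # (a2 # bs) @ [an]) d" "p < q"
            using hd.compressD[OF chd, of i p q] that A 3 length_box[of "i # p" as d]
              length_box[of "i # q" as d] by auto
          show "p @ [i] \<in> A" if "q @ [i] \<in> A" "p @ [i] \<in> box (a1 # (a2 # bs) @ [an]) d" "p < q"
            using last.compressD[OF clast, of p i q] that A 3 length_box[of "p @ [i]" as d]
              length_box[of "q @ [i]" as d] by (auto simp: append_less_append_iff)
        qed (use y z zy 3 in auto)
        then have "card (shadow (insert z (A - {y}))) \<le> card (shadow A)"
          using exchange[where as = "a1 # a2 # bs" and an = an and d = d, of A y z] A y z zy 3 by fastforce
        moreover have "card (insert z (A - {y})) = card A"
          using z(1) fA card_Suc_Diff1[OF fA y(1)] by simp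
        ultimately have "good (insert z (A - {y}))" using good z(1) by (auto simp: good_def)
        then have "sum rank A \<le> sum rank (insert z (A - {y}))" by (rule min)
        moreover have "sum rank A = rank y + sum rank (A - {y})"
          using fA y(1) by (rule sum.remove)
        moreover have "sum rank (insert z (A - {y})) = rank z + sum rank (A - {y})"
          using fA z by (intro sum.insert) auto
        ultimately have "rank y \<le> rank z" by simp
        then show False using mono[of z y] y(1) z(1) zy A by auto
      qed
      then have "A = seg ?B (card A)" by (rule initseg_eq_seg[OF finite_box])
      then show "card (shadow (seg ?B (card A0))) \<le> card (shadow A0)"
        using good by (simp add: good_def)
    qed
  qed
qed

section \<open>Growth of monomial ideals\<close>

abbreviation unit_mon :: "nat \<Rightarrow> nat \<Rightarrow>\<^sub>0 nat" where
  "unit_mon x \<equiv> Poly_Mapping.single x (Suc 0)"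

definition mons :: "nat set \<Rightarrow> (nat \<Rightarrow>\<^sub>0 nat) set" where
  "mons X = {u. Poly_Mapping.keys u \<subseteq> X}"

definition deg_part :: "(nat \<Rightarrow>\<^sub>0 nat) set \<Rightarrow> nat \<Rightarrow> (nat \<Rightarrow>\<^sub>0 nat) set" where
  "deg_part D d = {u \<in> D. mon_deg u = d}"

definition down_closed :: "(nat \<Rightarrow>\<^sub>0 nat) set \<Rightarrow> bool" where
  "down_closed D \<longleftrightarrow> (\<forall>u v. u + v \<in> D \<longrightarrow> u \<in> D)"

text \<open>
  Here \<open>D\<close> is the set of monomials outside the ideal. Since lists are indexed from \<open>0\<close>, the entry
  \<open>as ! i\<close> is the degree of the element number \<open>i + 1\<close> of the regular sequence.
\<close>

definition cover_cond :: "nat list \<Rightarrow> nat set \<Rightarrow> (nat \<Rightarrow>\<^sub>0 nat) set \<Rightarrow> bool" where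
  "cover_cond as X D \<longleftrightarrow>
     (\<forall>i < length as. \<forall>F \<subseteq> X. card F \<le> i \<longrightarrow> (\<exists>m \<in> mons (X - F) - D. mon_deg m \<le> as ! i))"

section \<open>Degrees of monomials and factorisation into variables\<close>

lemma mon_deg_sum: "finite X \<Longrightarrow> u \<in> mons X \<Longrightarrow> mon_deg u = (\<Sum>i \<in> X. Poly_Mapping.lookup u i)"
  unfolding mon_deg_def mons_def by (rule sum.mono_neutral_left) (auto simp: in_keys_iff)

lemma mon_deg_0 [simp]: "mon_deg 0 = 0"
  by (simp add: mon_deg_def)

lemma mon_deg_single [simp]: "mon_deg (Poly_Mapping.single x k) = k"
  by (simp add: mon_deg_def)

lemma keys_add_nat: "Poly_Mapping.keys (u + v :: 'a \<Rightarrow>\<^sub>0 nat) = Poly_Mapping.keys u \<union> Poly_Mapping.keys v"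
  by (auto simp: in_keys_iff lookup_add)

lemma mon_deg_add [simp]: "mon_deg (u + v) = mon_deg u + mon_deg v"
proof -
  let ?X = "Poly_Mapping.keys u \<union> Poly_Mapping.keys v"
  have "mon_deg w = (\<Sum>i \<in> ?X. Poly_Mapping.lookup w i)" if "w \<in> {u, v, u + v}" for w
    using that by (intro mon_deg_sum) (auto simp: mons_def keys_add_nat)
  then show ?thesis by (simp add: lookup_add sum.distrib)
qed

lemma mons_add_iff: "u + v \<in> mons X \<longleftrightarrow> u \<in> mons X \<and> v \<in> mons X"
  by (simp add: mons_def keys_add_nat)

lemma unit_mon_add_minus:
  assumes "x \<in> Poly_Mapping.keys u" shows "unit_mon x + (u - unit_mon x) = u"
  using assms
  by (intro poly_mapping_eqI) (auto simp: lookup_add lookup_minus lookup_single when_def in_keys_iff)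

lemma mon_deg_eq_0_iff: "mon_deg u = 0 \<longleftrightarrow> u = 0"
  by (auto simp: mon_deg_def in_keys_iff) (metis keys_eq_empty all_not_in_conv in_keys_iff)

lemma finite_deg_part_mons: "finite X \<Longrightarrow> finite (deg_part (mons X) d)"
proof (induction d)
  case 0
  then show ?case by (auto simp: deg_part_def mon_deg_eq_0_iff intro: finite_subset[of _ "{0}"])
next
  case (Suc d)
  have "deg_part (mons X) (Suc d) \<subseteq> (\<lambda>(x, u). unit_mon x + u) ` (X \<times> deg_part (mons X) d)"
  proof
    fix u assume u: "u \<in> deg_part (mons X) (Suc d)"
    then have "Poly_Mapping.keys u \<noteq> {}" by (auto simp: deg_part_def)
    then obtain x where x: "x \<in> Poly_Mapping.keys u" by blast
    note eq = unit_mon_add_minus[OF x]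
    have "mon_deg (unit_mon x + (u - unit_mon x)) = Suc d" "unit_mon x + (u - unit_mon x) \<in> mons X"
      using u unfolding eq by (auto simp: deg_part_def)
    then have "x \<in> X" "u - unit_mon x \<in> deg_part (mons X) d"
      unfolding mons_add_iff by (auto simp: deg_part_def mons_def)
    then show "u \<in> (\<lambda>(x, u). unit_mon x + u) ` (X \<times> deg_part (mons X) d)"
      by (intro image_eqI[of _ _ "(x, u - unit_mon x)"]) (simp_all only: case_prod_conv eq mem_Sigma_iff)
  qed
  with Suc show ?case by (auto intro: finite_subset)
qed

lemma finite_deg_part: "finite X \<Longrightarrow> D \<subseteq> mons X \<Longrightarrow> finite (deg_part D d)"
  by (rule finite_subset[OF _ finite_deg_part_mons[of X d]]) (auto simp: deg_part_def)

lemma mon_list: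
  "u \<in> mons X \<Longrightarrow> \<exists>xs. set xs \<subseteq> X \<and> length xs = mon_deg u \<and> u = sum_list (map unit_mon xs)"
proof (induction "mon_deg u" arbitrary: u)
  case 0
  then show ?case by (simp add: mon_deg_eq_0_iff)
next
  case (Suc d)
  then have "Poly_Mapping.keys u \<noteq> {}" by auto
  then obtain x where x: "x \<in> Poly_Mapping.keys u" by blast
  obtain v where v: "u = unit_mon x + v" using unit_mon_add_minus[OF x] by metis
  then have "d = mon_deg v" "v \<in> mons X" using Suc mons_add_iff[of _ v X] by auto
  then obtain xs where "set xs \<subseteq> X" "length xs = mon_deg v" "v = sum_list (map unit_mon xs)"
    using Suc.hyps(1) by blast
  moreover have "x \<in> X" using x Suc.prems by (auto simp: mons_def)
  ultimately show ?case using v by (intro exI[of _ "x # xs"]) auto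
qed

text \<open>Each position takes an element with the largest \<open>N\<close> value for the current
  prefix. The next element was still available then, which gives the comparison. The induction
  absorbs the chosen element into the prefix argument of \<open>N\<close>.\<close>

lemma greedy_order:
  fixes N :: "'a list \<Rightarrow> 'a \<Rightarrow> nat"
  shows "\<exists>ys. mset ys = mset xs \<and>
    (\<forall>j. Suc j < length ys \<longrightarrow> N (take j ys) (ys ! Suc j) \<le> N (take j ys) (ys ! j))"
proof (induction "length xs" arbitrary: xs N)
  case 0
  then show ?case by (intro exI[of _ "[]"]) simp
next
  case (Suc k)
  then have "Max (N [] ` set xs) \<in> N [] ` set xs" by (intro Max_in) auto
  then obtain y where y: "y \<in> set xs" "N [] y = Max (N [] ` set xs)" by auto
  have y_max: "N [] x \<le> N [] y" if "x \<in> set xs" for x using that y(2) by simp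
  obtain ys where ys: "mset ys = mset (remove1 y xs)"
    "\<forall>j. Suc j < length ys \<longrightarrow> N (y # take j ys) (ys ! Suc j) \<le> N (y # take j ys) (ys ! j)"
  proof -
    have "k = length (remove1 y xs)" using Suc.hyps(2) y(1) by (simp add: length_remove1)
    from Suc.hyps(1)[OF this, of "\<lambda>p. N (y # p)"] show ?thesis using that by blast
  qed
  have m: "mset (y # ys) = mset xs" using ys(1) y(1) by simp
  then have "set (y # ys) = set xs" by (metis set_mset_mset)
  then have "N (take j (y # ys)) ((y # ys) ! Suc j) \<le> N (take j (y # ys)) ((y # ys) ! j)"
    if "Suc j < length (y # ys)" for j
  proof (cases j)
    case 0
    have "ys ! 0 \<in> set ys" using that 0 by simp
    then have "ys ! 0 \<in> set xs" using \<open>set (y # ys) = set xs\<close> by auto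
    from y_max[OF this] show ?thesis using 0 by simp
  qed (use that ys(2) in auto)
  with m show ?case by blast
qed

lemma shadow_box_0: "A \<subseteq> box as 0 \<Longrightarrow> shadow A = {}"
  using incr_box[of _ _ as 0] by (auto simp: shadow_def)

text \<open>The second bound will make segments with these sizes closed under division. Layers of
  \<open>D\<close> along the factors of a monomial outside \<open>D\<close> live in one variable
  less; stacking segments of their sizes gives a set in the full box, with which the
  Clements-Lindstroem theorem compares the segment.\<close>

theorem monomial_growth:
  assumes "sorted as" "finite X" "card X = length as" "D \<subseteq> mons X" "down_closed D" "cover_cond as X D"
  shows "card (deg_part D d) \<le> card (box as d)"
    and "card (shadow (seg (box as (Suc d)) (card (deg_part D (Suc d))))) \<le> card (deg_part D d)"
proof -
  have "card (deg_part D d) \<le> card (box as d) \<and>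
    card (shadow (seg (box as (Suc d)) (card (deg_part D (Suc d))))) \<le> card (deg_part D d)"
    using assms
  proof (induction as arbitrary: X D d)
    case Nil
    then have "mons X = {0}" by (auto simp: mons_def)
    then have "deg_part D d \<subseteq> (if d = 0 then {0} else {})" "deg_part D (Suc d) = {}" 
      using Nil by (auto simp: deg_part_def)
    moreover have "box [] 0 = {[]}" by (auto simp: box_def)
    ultimately show ?case
      using card_mono[of "{0}" "deg_part D d"] by (cases "d = 0") auto
  next
    case (Cons a as)
    have D: "D \<subseteq> mons X" and fin: "finite X" by fact+
    have down: "v + u \<in> D \<Longrightarrow> u \<in> D" "u + v \<in> D \<Longrightarrow> u \<in> D" for u v
      using Cons.prems(5) by (auto simp: down_closed_def add.commute[of v u])
    obtain m0 where m0: "m0 \<in> mons X - D" "mon_deg m0 \<le> a"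
      using Cons.prems(6) unfolding cover_cond_def
      by (elim allE[of _ 0], elim impE) (auto elim!: allE[of _ "{}"])
    obtain x where x: "x \<in> X" using Cons.prems(2,3) by fastforce
    \<comment> \<open>Padding with a power of some variable makes the degree exactly
      \<open>a\<close>, so that there are as many layers as values of the first coordinate of the
      box.\<close>
    define m where "m = m0 + Poly_Mapping.single x (a - mon_deg m0)"
    have m: "m \<in> mons X" "m \<notin> D" "mon_deg m = a"
      using m0 x down(2)[of m0] by (auto simp: m_def mons_add_iff) (auto simp: mons_def)
    then obtain xs0 where xs0: "set xs0 \<subseteq> X" "length xs0 = a" "m = sum_list (map unit_mon xs0)"
      using mon_list by metis
    let ?p = "\<lambda>ys. sum_list (map unit_mon ys)"
    \<comment> \<open>This is the size, in total degree \<open>d\<close>, of the layer that follows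
      the prefix \<open>ys\<close> if \<open>y\<close> is the next factor. The order of the factors
      thus depends on \<open>d\<close>.\<close>
    define N where "N ys y = card {u. mon_deg u + length ys = d \<and> ?p ys + u \<in> D \<and>
        y \<notin> Poly_Mapping.keys u}" for ys y
    obtain xs where xs: "mset xs = mset xs0"
      "\<And>j. Suc j < length xs \<Longrightarrow> N (take j xs) (xs ! Suc j) \<le> N (take j xs) (xs ! j)"
      using greedy_order[where xs = xs0 and N = N] by blast
    have len: "length xs = a" using xs(1) xs0(2) by (metis mset_eq_length)
    have pm: "?p xs = m" using xs(1) xs0(3) by (metis mset_map sum_mset_sum_list)
    have xsX: "xs ! j \<in> X" if "j < a" for j
      using that len xs(1) xs0(1) by (metis nth_mem set_mset_mset subsetD)
    \<comment> \<open>\<open>E j e\<close> is the colon of \<open>D\<close> by the first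
      \<open>j\<close> factors, where \<open>e\<close> counts these factors too;
      \<open>G j e\<close> is the layer of its monomials free of the next factor.\<close>
    define E where "E j e = {u. mon_deg u + j = e \<and> ?p (take j xs) + u \<in> D}" for j e
    define G where "G j e = {u \<in> E j e. xs ! j \<notin> Poly_Mapping.keys u}" for j e
    have finE: "finite (E j e)" for j e
    proof (rule finite_subset)
      show "E j e \<subseteq> deg_part (mons X) (e - j)"
        using D by (auto simp: E_def deg_part_def dest: down(1))
    qed (rule finite_deg_part_mons[OF fin])
    have finG: "finite (G j e)" for j e by (simp add: G_def finE)
    have pSuc: "?p (take (Suc j) xs) = ?p (take j xs) + unit_mon (xs ! j)" if "j < a" for j
      using that len by (simp add: take_Suc_conv_app_nth)
    \<comment> \<open>Dividing by \<open>xs ! j\<close> takes the monomials of \<open>E j e\<close>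
      outside the layer bijectively to \<open>E (Suc j) e\<close>.\<close>
    have cardE: "card (E j e) = card (G j e) + card (E (Suc j) e)" if j: "j < a" for j e
    proof -
      have "E j e - G j e = (\<lambda>u. unit_mon (xs ! j) + u) ` E (Suc j) e"
      proof (intro equalityI subsetI)
        fix u assume u: "u \<in> E j e - G j e"
        then have key: "xs ! j \<in> Poly_Mapping.keys u" by (simp add: G_def)
        define v where "v = u - unit_mon (xs ! j)"
        have uv: "u = unit_mon (xs ! j) + v"
          unfolding v_def by (rule unit_mon_add_minus[OF key, symmetric])
        have "v \<in> E (Suc j) e" using u by (simp add: E_def pSuc[OF j] uv add.assoc)
        with uv show "u \<in> (\<lambda>u. unit_mon (xs ! j) + u) ` E (Suc j) e" by blast
      next
        fix u assume "u \<in> (\<lambda>u. unit_mon (xs ! j) + u) ` E (Suc j) e"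
        then obtain v where "v \<in> E (Suc j) e" "u = unit_mon (xs ! j) + v" by blast
        then show "u \<in> E j e - G j e"
          by (auto simp: E_def G_def pSuc[OF j] add.assoc keys_add_nat)
      qed
      then have "card (E j e - G j e) = card (E (Suc j) e)"
        by (simp add: card_image inj_on_def)
      moreover have "card (E j e - G j e) = card (E j e) - card (G j e)" "card (G j e) \<le> card (E j e)"
        by (auto simp: G_def finE intro!: card_Diff_subset card_mono)
      ultimately show ?thesis by simp
    qed
    have "E a e = {}" for e using len pm m(2) by (auto simp: E_def dest: down(2))
    moreover have "card (E 0 e) = (\<Sum>j<k. card (G j e)) + card (E k e)" if "k \<le> a" for k e
      using that by (induction k) (auto simp: cardE)
    moreover have "E 0 e = deg_part D e" for e by (auto simp: E_def deg_part_def)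
    ultimately have card_D: "card (deg_part D e) = (\<Sum>j<a. card (G j e))" for e
      by (metis add.right_neutral card.empty order_refl)
    have G_empty: "G j e = {}" if "e < j" for j e using that by (auto simp: G_def E_def)
    have IH: "card (G j e) \<le> card (box as (e - j))"
      "card (shadow (seg (box as (Suc e - j)) (card (G j (Suc e))))) \<le> card (G j e)"
      if j: "j < a" "j \<le> e" for j e
    proof -
      define D' where "D' = {u. ?p (take j xs) + u \<in> D \<and> xs ! j \<notin> Poly_Mapping.keys u}"
      have G: "G j e' = deg_part D' (e' - j)" if "j \<le> e'" for e'
        using that by (auto simp: G_def E_def D'_def deg_part_def)
      have 1: "card (X - {xs ! j}) = length as" using Cons.prems(2,3) xsX[OF j(1)] by simp
      have 2: "D' \<subseteq> mons (X - {xs ! j})" using D by (auto simp: D'_def mons_def dest: down(1))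
      have 3: "down_closed D'"
        unfolding down_closed_def
      proof (intro allI impI)
        fix u v assume "u + v \<in> D'"
        then have "(?p (take j xs) + u) + v \<in> D" "xs ! j \<notin> Poly_Mapping.keys u"
          by (auto simp: D'_def keys_add_nat add.assoc)
        then show "u \<in> D'" using down(2) by (simp add: D'_def)
      qed
      \<comment> \<open>Adding the removed variable to \<open>F\<close> raises its size by at most
        one, which matches dropping the first entry of the list of degrees.\<close>
      have 4: "cover_cond as (X - {xs ! j}) D'"
        unfolding cover_cond_def
      proof (intro allI impI)
        fix i F assume i: "i < length as" and F: "F \<subseteq> X - {xs ! j}" "card F \<le> i"
        have "card (insert (xs ! j) F) \<le> Suc i" using F(2) card_insert_le_m1[of "Suc i" F] by simp
        moreover have "insert (xs ! j) F \<subseteq> X" "Suc i < length (a # as)"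
          using F(1) xsX[OF j(1)] i by auto
        ultimately obtain v
          where v: "v \<in> mons (X - insert (xs ! j) F) - D" "mon_deg v \<le> (a # as) ! Suc i"
          using Cons.prems(6) unfolding cover_cond_def by blast
        then have "v \<in> mons (X - {xs ! j} - F) - D'"
          by (auto simp: D'_def mons_def dest: down(1))
        then show "\<exists>v \<in> mons (X - {xs ! j} - F) - D'. mon_deg v \<le> as ! i" using v(2) by auto
      qed
      show "card (G j e) \<le> card (box as (e - j))"
        "card (shadow (seg (box as (Suc e - j)) (card (G j (Suc e))))) \<le> card (G j e)"
        using Cons.IH[OF _ _ 1 2 3 4, of "e - j"] Cons.prems(1,2) j(2) by (auto simp: G Suc_diff_le)
    qed
    interpret layering "(#)" a "a # as" as by (rule layering_Cons)
    define c where "c e j = (if j < a then card (G j e) else 0)" for e j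
    have c_le: "c e j \<le> card (box as (e - j))" for e j
      using IH(1)[of j e] G_empty[of e j] by (cases "j \<le> e") (auto simp: c_def not_le)
    have c_0: "a \<le> j \<or> e < j \<Longrightarrow> c e j = 0" for e j
      using G_empty[of e j] by (auto simp: c_def)
    note segs = segs_box[of "c e" e for e, OF c_le c_0] card_segs[of "c e" e for e, OF c_le c_0]
      card_shadow_segs[of "c e" e for e, OF c_le c_0]
    have card_segs_D: "card (segs e (c e)) = card (deg_part D e)" for e
      using segs(2)[of e] by (simp add: card_D c_def)
    have step: "max (card (shadow (seg (box as (Suc d - j)) (c (Suc d) j)))) (c (Suc d) (Suc j))
        \<le> card (G j d)"
      if j: "j < a" for j
    proof (cases "j \<le> d")
      case True
      have "c (Suc d) (Suc j) \<le> card (G j d)"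
      proof (cases "Suc j < a")
        case Suc: True
        let ?U = "{u. mon_deg u + length (take j xs) = d \<and> ?p (take j xs) + u \<in> D \<and>
            xs ! Suc j \<notin> Poly_Mapping.keys u}"
        have U: "?U \<subseteq> E j d" using j len by (auto simp: E_def)
        \<comment> \<open>Cancelling the factor \<open>xs ! j\<close> lowers the total degree to
          \<open>d\<close> and stays inside \<open>D\<close>. The set \<open>?U\<close> is the layer
          that \<open>xs ! Suc j\<close> would have given at position \<open>j\<close>, and the
          greedy order preferred \<open>xs ! j\<close> there.\<close>
        have "G (Suc j) (Suc d) \<subseteq> ?U"
        proof
          fix u assume u: "u \<in> G (Suc j) (Suc d)"
          then have "(?p (take j xs) + u) + unit_mon (xs ! j) \<in> D"
            by (simp add: G_def E_def pSuc[OF j] ac_simps)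
          from down(2)[OF this] u show "u \<in> ?U" using j len by (auto simp: G_def E_def)
        qed
        then have "card (G (Suc j) (Suc d)) \<le> N (take j xs) (xs ! Suc j)"
          unfolding N_def using finite_subset[OF U finE] by (rule card_mono[rotated])
        also have "\<dots> \<le> N (take j xs) (xs ! j)" using xs(2) Suc len by simp
        also have "\<dots> = card (G j d)"
          unfolding N_def G_def E_def using j len by (intro arg_cong[of _ _ card]) auto
        finally show ?thesis using Suc by (simp add: c_def)
      qed (simp add: c_def)
      moreover have "c (Suc d) j = card (G j (Suc d))" using j by (simp add: c_def)
      ultimately show ?thesis using IH(2)[OF j True] by simp
    next
      case False
      \<comment> \<open>Here \<open>Suc d - j\<close> is \<open>0\<close>, and vectors of degree
        zero have nothing below them.\<close>
      then have "shadow (seg (box as (Suc d - j)) (c (Suc d) j)) = {}"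
        using shadow_box_0[OF seg_subset[OF finite_box]] by simp
      moreover have "c (Suc d) (Suc j) = 0" using False c_0 by simp
      ultimately show ?thesis by simp
    qed
    have "card (shadow (segs (Suc d) (c (Suc d)))) = (\<Sum>j<a.
        max (card (shadow (seg (box as (Suc d - j)) (c (Suc d) j)))) (c (Suc d) (Suc j)))"
      using segs(3)[of "Suc d"] by simp
    also have "\<dots> \<le> (\<Sum>j<a. card (G j d))"
      by (rule sum_mono) (simp only: lessThan_iff step)
    finally have "card (shadow (segs (Suc d) (c (Suc d)))) \<le> card (deg_part D d)"
      by (simp only: card_D)
    moreover have "card (shadow (seg (box (a # as) (Suc d)) (card (deg_part D (Suc d)))))
        \<le> card (shadow (segs (Suc d) (c (Suc d))))"
      using seg_optimal_sorted[OF Cons.prems(1)] segs(1)[of "Suc d"]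
      by (auto simp: seg_optimal_def simp flip: card_segs_D)
    moreover have "card (deg_part D d) \<le> card (box (a # as) d)"
      using card_mono[OF finite_box segs(1)[of d]] by (simp add: card_segs_D)
    ultimately show ?case by linarith
  qed
  then show "card (deg_part D d) \<le> card (box as d)"
    "card (shadow (seg (box as (Suc d)) (card (deg_part D (Suc d))))) \<le> card (deg_part D d)"
    by blast+
qed

section \<open>Regular sequences and ideals generated by variables\<close>

interpretation mpoly_space: vector_space "\<lambda>c (p :: 'k::field mpoly). Poly_Mapping.single 0 c * p"
  by unfold_locales (simp_all add: distrib_left distrib_right single_add mult_single flip: mult.assoc)

section \<open>The polynomial ring and its ideals in terms of type-class operations\<close>

lemma mem_carrier: "p \<in> carrier (poly_ring n) \<longleftrightarrow> (\<forall>m \<in> Poly_Mapping.keys p. Poly_Mapping.keys m \<subseteq> {1..n})"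
  by (simp add: poly_ring_def)

lemma carrier_add:
  "p \<in> carrier (poly_ring n) \<Longrightarrow> q \<in> carrier (poly_ring n) \<Longrightarrow> p + q \<in> carrier (poly_ring n)"
  using Poly_Mapping.keys_add[of p q] by (auto simp: mem_carrier)

lemma carrier_mult:
  assumes "p \<in> carrier (poly_ring n)" "q \<in> carrier (poly_ring n)"
  shows "p * q \<in> carrier (poly_ring n :: 'k::field mpoly ring)"
proof -
  interpret cring "poly_ring n :: 'k mpoly ring" by (rule cring_poly_ring)
  show ?thesis using m_closed[OF assms] by (simp add: poly_ring_simps)
qed

lemma carrier_single [simp]:
  "Poly_Mapping.keys m \<subseteq> {1..n} \<Longrightarrow> Poly_Mapping.single m c \<in> carrier (poly_ring n)"
  by (simp add: mem_carrier)

lemma carrier_single_0 [simp]: "Poly_Mapping.single 0 c \<in> carrier (poly_ring n)"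
  by simp

lemma carrier_0 [simp]: "0 \<in> carrier (poly_ring n)"
  by (simp add: mem_carrier)

lemma carrier_1 [simp]: "1 \<in> carrier (poly_ring n)"
  by (simp add: mem_carrier)

lemma carrier_uminus: "p \<in> carrier (poly_ring n) \<Longrightarrow> - p \<in> carrier (poly_ring n)"
  by (simp add: mem_carrier)

lemma carrier_sum: "(\<And>x. x \<in> A \<Longrightarrow> g x \<in> carrier (poly_ring n)) \<Longrightarrow> sum g A \<in> carrier (poly_ring n)"
  by (induction A rule: infinite_finite_induct) (auto intro: carrier_add)

lemma carrier_power: "p \<in> carrier (poly_ring n) \<Longrightarrow> p ^ k \<in> carrier (poly_ring n)"
  by (induction k) (auto intro: carrier_mult)

lemma poly_ring_idealI:
  fixes I :: "'k::field mpoly set"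
  assumes "I \<subseteq> carrier (poly_ring n)" "0 \<in> I" "\<And>p q. p \<in> I \<Longrightarrow> q \<in> I \<Longrightarrow> p + q \<in> I"
    "\<And>p q. p \<in> I \<Longrightarrow> q \<in> carrier (poly_ring n) \<Longrightarrow> q * p \<in> I"
  shows "ideal I (poly_ring n)"
proof -
  let ?R = "poly_ring n :: 'k mpoly ring"
  interpret cring ?R by (rule cring_poly_ring)
  have neg: "\<ominus>\<^bsub>?R\<^esub> p = - p" if "p \<in> carrier ?R" for p
    using that by (intro minus_equality) (auto simp: poly_ring_simps carrier_uminus)
  have "- p \<in> I" if "p \<in> I" for p
    using assms(4)[OF that carrier_uminus[OF carrier_1]] by simp
  then have "subgroup I (add_monoid ?R)"
    using assms(1-3) neg
    by (intro group.subgroupI[OF a_group]) (auto simp: poly_ring_simps a_inv_def subset_iff)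
  then show ?thesis
    using assms(4) by (intro idealI ring_axioms) (auto simp: poly_ring_simps mult.commute)
qed

lemma poly_ring_idealD:
  fixes I :: "'k::field mpoly set"
  assumes "ideal I (poly_ring n)"
  shows "I \<subseteq> carrier (poly_ring n)" "0 \<in> I" "\<And>p q. p \<in> I \<Longrightarrow> q \<in> I \<Longrightarrow> p + q \<in> I"
    "\<And>p q. p \<in> I \<Longrightarrow> q \<in> carrier (poly_ring n) \<Longrightarrow> q * p \<in> I"
    "\<And>p q. p + q \<in> I \<Longrightarrow> q \<in> I \<Longrightarrow> p \<in> I"
proof -
  interpret ideal I "poly_ring n :: 'k mpoly ring" by fact
  show "I \<subseteq> carrier (poly_ring n)" by (rule a_subset)
  show "0 \<in> I" using additive_subgroup.zero_closed[OF is_additive_subgroup] by (simp add: poly_ring_simps)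
  show add: "p + q \<in> I" if "p \<in> I" "q \<in> I" for p q
    using additive_subgroup.a_closed[OF is_additive_subgroup that] by (simp add: poly_ring_simps)
  show mult: "q * p \<in> I" if "p \<in> I" "q \<in> carrier (poly_ring n)" for p q
    using I_l_closed[OF that] by (simp add: poly_ring_simps)
  show "p \<in> I" if "p + q \<in> I" "q \<in> I" for p q
    using add[OF that(1) mult[OF that(2) carrier_uminus[OF carrier_1]]] by simp
qed

section \<open>Counting polynomials that are independent modulo an ideal\<close>

definition indep_mod :: "'k::field mpoly set \<Rightarrow> nat \<Rightarrow> (nat \<Rightarrow> 'k mpoly) \<Rightarrow> bool" where
  "indep_mod I K v \<longleftrightarrow>
     (\<forall>c. (\<Sum>x<K. Poly_Mapping.single 0 (c x) * v x) \<in> I \<longrightarrow> (\<forall>x<K. c x = 0))"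

lemma sum_lessThan_add:
  fixes g :: "nat \<Rightarrow> 'a::comm_monoid_add"
  shows "sum g {..<m + n} = sum g {..<m} + (\<Sum>x<n. g (m + x))"
  by (induction n) (simp_all add: add.assoc)

text \<open>
  Families are indexed by initial segments of the naturals; the index \<open>x\<close> of the new family encodes
  the exponent \<open>x div K\<close> and the old index \<open>x mod K\<close>.
\<close>

lemma indep_mod_step:
  fixes I :: "'k::field mpoly set"
  assumes I: "ideal I (poly_ring n)" and I': "ideal I' (poly_ring n)" and sub: "I \<subseteq> I'"
    and f: "f \<in> I'" and nz: "\<And>g. g \<in> carrier (poly_ring n) \<Longrightarrow> f * g \<in> I \<Longrightarrow> g \<in> I"
    and v: "\<And>x. x < K \<Longrightarrow> v x \<in> carrier (poly_ring n)" and ind: "indep_mod I' K v"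
  shows "indep_mod I (K * N) (\<lambda>x. f ^ (x div K) * v (x mod K))"
proof (cases "K = 0")
  case True
  then show ?thesis by (simp add: indep_mod_def)
next
  case False
  note I = poly_ring_idealD[OF I] and I' = poly_ring_idealD[OF I']
  let ?w = "\<lambda>x. f ^ (x div K) * v (x mod K)"
  have w: "?w x \<in> carrier (poly_ring n)" for x
    using f I'(1) False by (intro carrier_mult carrier_power v) auto
  show ?thesis
  proof (induction N)
    case (Suc N)
    show ?case unfolding indep_mod_def
    proof (intro allI impI)
      fix c x
      assume mem: "(\<Sum>x<K * Suc N. Poly_Mapping.single 0 (c x) * ?w x) \<in> I" and x: "x < K * Suc N"
      let ?A = "\<Sum>x<K. Poly_Mapping.single 0 (c x) * v x"
      let ?B = "\<Sum>x<K * N. Poly_Mapping.single 0 (c (K + x)) * ?w x"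
      have B: "?B \<in> carrier (poly_ring n)" by (intro carrier_sum carrier_mult w carrier_single_0)
      \<comment> \<open>Indices below \<open>K\<close> carry no \<open>f\<close>, all others carry a
        factor \<open>f\<close>. Modulo \<open>I'\<close> only the former survive, so their
        coefficients vanish; then \<open>f\<close> is cancelled modulo \<open>I\<close>.\<close>
      have "(\<Sum>x<K * Suc N. Poly_Mapping.single 0 (c x) * ?w x) = ?A + f * ?B"
        using False by (simp add: sum_lessThan_add sum_distrib_left mult_ac)
      then have AB: "?A + f * ?B \<in> I" using mem by simp
      moreover have fB: "f * ?B \<in> I'" using I'(4)[OF f B] by (simp add: mult.commute)
      ultimately have "?A \<in> I'" using I'(5) sub by blast
      then have c0: "\<forall>x<K. c x = 0" using ind unfolding indep_mod_def by blast
      then have "?A = 0" by (intro sum.neutral) simp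
      then have "?B \<in> I" using nz[OF B] AB by simp
      then have c1: "\<forall>x<K * N. c (K + x) = 0" 
        using Suc.IH[unfolded indep_mod_def, THEN spec[of _ "\<lambda>x. c (K + x)"]] by simp
      show "c x = 0"
      proof (cases "x < K")
        case False
        then have "x = K + (x - K)" "x - K < K * N" using x by auto
        then show ?thesis using c1 by metis
      qed (use c0 in simp)
    qed
  qed (simp add: indep_mod_def)
qed

definition deg_le :: "nat \<Rightarrow> 'k::field mpoly \<Rightarrow> bool" where
  "deg_le D p \<longleftrightarrow> (\<forall>m \<in> Poly_Mapping.keys p. mon_deg m \<le> D)"

lemma deg_le_mult: "deg_le D p \<Longrightarrow> deg_le E q \<Longrightarrow> deg_le (D + E) (p * q)"
proof -
  assume pq: "deg_le D p" "deg_le E q"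
  have "mon_deg m \<le> D + E" if m: "m \<in> Poly_Mapping.keys (p * q)" for m
  proof -
    obtain a b where "m = a + b" "a \<in> Poly_Mapping.keys p" "b \<in> Poly_Mapping.keys q"
      using m Poly_Mapping.keys_mult[of p q] by blast
    then show ?thesis using pq by (auto simp: deg_le_def intro: add_mono)
  qed
  then show ?thesis by (simp add: deg_le_def)
qed

lemma deg_le_mono: "deg_le D p \<Longrightarrow> D \<le> E \<Longrightarrow> deg_le E p"
  by (auto simp: deg_le_def)

lemma deg_le_power: "deg_le D p \<Longrightarrow> deg_le (k * D) (p ^ k)"
proof (induction k)
  case (Suc k)
  then show ?case using deg_le_mult[of D p "k * D" "p ^ k"] by simp
qed (simp add: deg_le_def)

text \<open>A lower bound \<open>K\<close> for the dimension, modulo \<open>I\<close>, of the space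
  of polynomials of degree at most \<open>D\<close>, expressed by a family that witnesses
  it.\<close>

definition large_mod :: "nat \<Rightarrow> 'k::field mpoly set \<Rightarrow> nat \<Rightarrow> nat \<Rightarrow> bool" where
  "large_mod n I K D \<longleftrightarrow>
     (\<exists>v. (\<forall>x<K. v x \<in> carrier (poly_ring n) \<and> deg_le D (v x)) \<and> indep_mod I K v)"

lemma large_mod_mono: "large_mod n I' K D \<Longrightarrow> I \<subseteq> I' \<Longrightarrow> large_mod n I K D"
  unfolding large_mod_def indep_mod_def by (meson subsetD)

lemma large_mod_step:
  fixes I :: "'k::field mpoly set"
  assumes "ideal I (poly_ring n)" "ideal I' (poly_ring n)" "I \<subseteq> I'" "f \<in> I'"
    "\<And>g. g \<in> carrier (poly_ring n) \<Longrightarrow> f * g \<in> I \<Longrightarrow> g \<in> I"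
    and large: "large_mod n I' K D" and deg: "deg_le b f"
  shows "large_mod n I (K * N) (D + N * b)"
proof -
  obtain v where v: "\<And>x. x < K \<Longrightarrow> v x \<in> carrier (poly_ring n)" "\<And>x. x < K \<Longrightarrow> deg_le D (v x)"
    and ind: "indep_mod I' K v"
    using large unfolding large_mod_def by blast
  let ?w = "\<lambda>x. f ^ (x div K) * v (x mod K)"
  have "?w x \<in> carrier (poly_ring n) \<and> deg_le (D + N * b) (?w x)" if x: "x < K * N" for x
  proof -
    have K: "x mod K < K" using x by (cases "K = 0") auto
    have "x div K \<le> N" using less_mult_imp_div_less[of x N K] x by (simp add: mult.commute)
    then have le: "(x div K) * b + D \<le> D + N * b" by simp
    have "f \<in> carrier (poly_ring n)" using assms(2,4) poly_ring_idealD(1) by blast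
    then show ?thesis
      using deg_le_mono[OF deg_le_mult[OF deg_le_power[OF deg] v(2)[OF K]] le] v(1)[OF K]
      by (auto intro: carrier_mult carrier_power)
  qed
  moreover have "indep_mod I (K * N) ?w"
    by (rule indep_mod_step[OF assms(1-5) v(1) ind])
  ultimately show ?thesis unfolding large_mod_def by (intro exI[of _ ?w]) simp
qed

lemma card_bounded_mons:
  assumes "finite X"
  shows "finite {m \<in> mons X. mon_deg m \<le> D}" "card {m \<in> mons X. mon_deg m \<le> D} \<le> Suc D ^ card X"
proof -
  let ?M = "{m \<in> mons X. mon_deg m \<le> D}" and ?g = "\<lambda>m. restrict (Poly_Mapping.lookup m) X"
  have inj: "inj_on ?g ?M"
  proof (rule inj_onI)
    fix u v assume uv: "u \<in> ?M" "v \<in> ?M" "?g u = ?g v"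
    show "u = v"
    proof (rule poly_mapping_eqI)
      fix x show "Poly_Mapping.lookup u x = Poly_Mapping.lookup v x"
      proof (cases "x \<in> X")
        case True
        then show ?thesis using fun_cong[OF uv(3), of x] by simp
      next
        case False
        then have "x \<notin> Poly_Mapping.keys u" "x \<notin> Poly_Mapping.keys v"
          using uv(1,2) by (auto simp: mons_def)
        then show ?thesis by (simp add: in_keys_iff)
      qed
    qed
  qed
  have im: "?g ` ?M \<subseteq> X \<rightarrow>\<^sub>E {..D}"
  proof
    fix g assume "g \<in> ?g ` ?M"
    then obtain m where m: "m \<in> mons X" "mon_deg m \<le> D" "g = ?g m" by blast
    have "Poly_Mapping.lookup m x \<le> D" if "x \<in> X" for x
      using m(2) member_le_sum[of x X "Poly_Mapping.lookup m"] that assms mon_deg_sum[OF assms m(1)]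
      by simp
    then show "g \<in> X \<rightarrow>\<^sub>E {..D}" using m(3) by auto
  qed
  have fin: "finite (X \<rightarrow>\<^sub>E {..D})" using assms by (intro finite_PiE) auto
  show "finite ?M" using finite_imageD[OF finite_subset[OF im fin] inj] .
  show "card ?M \<le> Suc D ^ card X"
    using card_inj_on_le[OF inj im fin] assms by (simp add: card_PiE)
qed

lemma sum_single_keys:
  "(\<Sum>m \<in> Poly_Mapping.keys p. Poly_Mapping.single m (Poly_Mapping.lookup p m)) = p"
  by (rule poly_mapping_eqI) (auto simp: lookup_sum lookup_single when_def in_keys_iff)

lemma indep_card_le:
  fixes v :: "nat \<Rightarrow> 'k::field mpoly"
  assumes T: "finite T" and v: "\<And>x. x < K \<Longrightarrow> Poly_Mapping.keys (v x) \<subseteq> T" and ind: "indep_mod {0} K v"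
  shows "K \<le> card T"
proof -
  have D: "c x = 0" if "(\<Sum>x<K. Poly_Mapping.single 0 (c x) * v x) = 0" "x < K" for c x
    using ind that unfolding indep_mod_def by blast
  have inj: "inj_on v {..<K}"
  proof (rule inj_onI, rule ccontr)
    fix x y assume xy: "x \<in> {..<K}" "y \<in> {..<K}" "v x = v y" "x \<noteq> y"
    let ?c = "\<lambda>z. if z = x then 1 else if z = y then - 1 else 0 :: 'k"
    have "(\<Sum>z<K. Poly_Mapping.single 0 (?c z) * v z) =
        (\<Sum>z \<in> {x, y}. Poly_Mapping.single 0 (?c z) * v z)"
      using xy by (intro sum.mono_neutral_right) auto
    also have "\<dots> = 0" using xy by (simp add: single_uminus)
    finally show False using D[of ?c x] xy by simp
  qed
  let ?b = "\<lambda>m. Poly_Mapping.single m (1 :: 'k)"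
  have "v x \<in> mpoly_space.span (?b ` T)" if "x < K" for x
  proof -
    have "Poly_Mapping.single m c \<in> mpoly_space.span (?b ` T)" if "m \<in> T" for m c
      using mpoly_space.span_scale[OF mpoly_space.span_base, of "?b m" "?b ` T" c] that
      by (simp add: mult_single)
    then have "(\<Sum>m \<in> Poly_Mapping.keys (v x). Poly_Mapping.single m (Poly_Mapping.lookup (v x) m))
        \<in> mpoly_space.span (?b ` T)"
      using v[OF that] by (intro mpoly_space.span_sum) auto
    then show ?thesis by (simp add: sum_single_keys)
  qed
  then have span: "v ` {..<K} \<subseteq> mpoly_space.span (?b ` T)" by auto
  have "mpoly_space.independent (v ` {..<K})"
    unfolding mpoly_space.dependent_finite[OF finite_imageI[OF finite_lessThan]]
    using D[of "\<lambda>x. u (v x)" for u] inj by (auto simp: sum.reindex)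
  then have "card (v ` {..<K}) \<le> card (?b ` T)"
    using mpoly_space.independent_span_bound[OF finite_imageI[OF T] _ span] by blast
  then show ?thesis using card_image_le[OF T, of ?b] inj by (simp add: card_image)
qed

lemma large_mod_zero_le:
  assumes "large_mod n ({0} :: 'k::field mpoly set) K D"
  shows "K \<le> Suc D ^ n"
proof -
  obtain v :: "nat \<Rightarrow> 'k mpoly" where "\<And>x. x < K \<Longrightarrow> v x \<in> carrier (poly_ring n) \<and> deg_le D (v x)"
    and ind: "indep_mod {0} K v"
    using assms unfolding large_mod_def by blast
  then have "Poly_Mapping.keys (v x) \<subseteq> {m \<in> mons {1..n}. mon_deg m \<le> D}" if "x < K" for x
    using that by (fastforce simp: mem_carrier deg_le_def mons_def)
  then show ?thesis
    using order_trans[OF indep_card_le[OF card_bounded_mons(1) _ ind] card_bounded_mons(2)]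
    by (metis card_atLeastAtMost diff_Suc_1 finite_atLeastAtMost)
qed

text \<open>The ideal generated by the variables with index in \<open>F\<close>, described so that
  membership is read off term by term.\<close>

definition var_prime :: "nat \<Rightarrow> nat set \<Rightarrow> 'k::field mpoly set" where
  "var_prime n F = {p \<in> carrier (poly_ring n). \<forall>m \<in> Poly_Mapping.keys p. Poly_Mapping.keys m \<inter> F \<noteq> {}}"

lemma ideal_var_prime: "ideal (var_prime n F) (poly_ring n)"
proof (rule poly_ring_idealI)
  fix p q :: "'a mpoly"
  assume p: "p \<in> var_prime n F"
  show "p + q \<in> var_prime n F" if "q \<in> var_prime n F"
    using p that Poly_Mapping.keys_add[of p q] by (auto simp: var_prime_def carrier_add)
  show "q * p \<in> var_prime n F" if q: "q \<in> carrier (poly_ring n)"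
  proof -
    have "Poly_Mapping.keys m \<inter> F \<noteq> {}" if m: "m \<in> Poly_Mapping.keys (q * p)" for m
    proof -
      obtain a b where "m = a + b" "b \<in> Poly_Mapping.keys p"
        using m Poly_Mapping.keys_mult[of q p] by blast
      then show ?thesis using p by (auto simp: var_prime_def keys_add_nat)
    qed
    then show ?thesis using p q by (simp add: var_prime_def carrier_mult)
  qed
qed (auto simp: var_prime_def)

lemma keys_var_mult:
  "Poly_Mapping.keys (var i * p :: 'k::field mpoly) = (\<lambda>m. unit_mon i + m) ` Poly_Mapping.keys p"
proof -
  have look: "Poly_Mapping.lookup (var i * p) (unit_mon i + m) = Poly_Mapping.lookup p m" for m
  proof -
    have "var i * p = (\<Sum>k \<in> Poly_Mapping.keys p.
        Poly_Mapping.single (unit_mon i + k) (Poly_Mapping.lookup p k))"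
      by (subst sum_single_keys[of p, symmetric])
        (simp add: sum_distrib_left var_def mult_single del: sum_single_keys)
    then show ?thesis
      by (simp add: lookup_sum lookup_single when_def in_keys_iff)
  qed
  show ?thesis
  proof (intro equalityI subsetI)
    fix m assume m: "m \<in> Poly_Mapping.keys (var i * p)"
    then obtain a b where "m = a + b" "a \<in> Poly_Mapping.keys (var i :: 'k mpoly)"
      using Poly_Mapping.keys_mult[of "var i" p] by blast
    then have "m = unit_mon i + b" by (simp add: var_def)
    then show "m \<in> (\<lambda>m. unit_mon i + m) ` Poly_Mapping.keys p"
      using m look by (auto simp: in_keys_iff)
  qed (auto simp: in_keys_iff look)
qed

text \<open>A variable outside \<open>F\<close> is a nonzerodivisor modulo this ideal. Adding such
  variables to \<open>F\<close> one at a time ends at the ideal of all variables, modulo which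
  \<open>1\<close> is independent; each of them contributes a factor \<open>N\<close>.\<close>

lemma large_mod_var_prime:
  assumes "F \<subseteq> {1..n}"
  shows "large_mod n (var_prime n F :: 'k::field mpoly set) (N ^ (n - card F)) ((n - card F) * N)"
  using assms
proof (induction "n - card F" arbitrary: F)
  case 0
  then have "F = {1..n}" by (metis card_atLeastAtMost card_seteq diff_Suc_1 diff_is_0_eq finite_atLeastAtMost)
  have "indep_mod (var_prime n F :: 'k mpoly set) 1 (\<lambda>_. 1)"
    by (auto simp: indep_mod_def var_prime_def split: if_splits)
  then show ?case unfolding large_mod_def 0(1)[symmetric]
    by (intro exI[of _ "\<lambda>_. 1"]) (simp add: deg_le_def)
next
  case (Suc k)
  have fin: "finite F" using Suc.prems finite_subset by blast
  have "F \<noteq> {1..n}" using Suc.hyps(2) by auto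
  then obtain i where i: "i \<in> {1..n}" "i \<notin> F" using Suc.prems by blast
  let ?F = "insert i F"
  have k: "k = n - card ?F" using Suc.hyps(2) fin i by simp
  have F: "?F \<subseteq> {1..n}" using i Suc.prems by simp
  note IH = Suc.hyps(1)[OF k F]
  have "large_mod n (var_prime n F :: 'k mpoly set) (N ^ (n - card ?F) * N) ((n - card ?F) * N + N * 1)"
  proof (rule large_mod_step[OF ideal_var_prime ideal_var_prime _ _ _ IH])
    show "var_prime n F \<subseteq> (var_prime n ?F :: 'k mpoly set)" by (auto simp: var_prime_def)
    show "var i \<in> var_prime n ?F" using i(1) by (simp add: var_prime_def var_def)
    show "deg_le 1 (var i :: 'k mpoly)" by (simp add: deg_le_def var_def)
    fix g :: "'k mpoly" assume "g \<in> carrier (poly_ring n)" "var i * g \<in> var_prime n F"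
    then show "g \<in> var_prime n F"
      using i(2) by (auto simp: var_prime_def keys_var_mult keys_add_nat)
  qed
  then show ?case unfolding k[symmetric] Suc.hyps(2)[symmetric] by (simp add: ac_simps)
qed

text \<open>The elements are removed from the last to the first. Regularity supplies the
  cancellation needed at each removal, and each one contributes a factor \<open>N\<close>.\<close>

lemma regular_sequence_large:
  fixes f :: "nat \<Rightarrow> 'k::field mpoly"
  assumes reg: "regular_sequence (poly_ring n) t f"
    and i: "i \<le> t" and large: "large_mod n (genideal (poly_ring n) (f ` {1..i})) K D"
    and deg: "\<And>j. 1 \<le> j \<Longrightarrow> j \<le> i \<Longrightarrow> deg_le b (f j)"
  shows "large_mod n (genideal (poly_ring n) {} :: 'k mpoly set) (K * N ^ i) (D + i * (N * b))"
  using i large deg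
proof (induction i arbitrary: K D)
  case (Suc i)
  let ?R = "poly_ring n :: 'k mpoly ring"
  interpret cring ?R by (rule cring_poly_ring)
  have f: "f ` {1..t} \<subseteq> carrier ?R" using reg by (simp add: regular_sequence_def)
  then have sub: "f ` {1..i} \<subseteq> carrier ?R" "f ` {1..Suc i} \<subseteq> carrier ?R"
    using Suc.prems(1) by (auto simp: image_subset_iff)
  have "large_mod n (genideal ?R (f ` {1..i})) (K * N) (D + N * b)"
  proof (rule large_mod_step[where f = "f (Suc i)", OF genideal_ideal[OF sub(1)] genideal_ideal[OF sub(2)]
        _ _ _ Suc.prems(2)])
    have "f ` {1..i} \<subseteq> genideal ?R (f ` {1..Suc i})"
      using genideal_self[OF sub(2)] by auto
    then show "genideal ?R (f ` {1..i}) \<subseteq> genideal ?R (f ` {1..Suc i})"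
      by (rule genideal_minimal[OF genideal_ideal[OF sub(2)]])
    show "f (Suc i) \<in> genideal ?R (f ` {1..Suc i})" using genideal_self[OF sub(2)] by auto
    show "deg_le b (f (Suc i))" using Suc.prems(3) by simp
    fix g assume "g \<in> carrier ?R" "f (Suc i) * g \<in> genideal ?R (f ` {1..i})"
    moreover have "{1..<Suc i} = {1..i}" "Suc i \<in> {1..t}" using Suc.prems(1) by auto
    ultimately show "g \<in> genideal ?R (f ` {1..i})"
      using reg unfolding regular_sequence_def by (metis poly_ring_simps(1))
  qed
  then have "large_mod n (genideal ?R {}) (K * N * N ^ i) (D + N * b + i * (N * b))"
    using Suc.IH[of "K * N" "D + N * b"] Suc.prems by simp
  then show ?case by (simp add: algebra_simps)
qed simp

text \<open>A special case of the height bound for regular sequences, proved by counting. Since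
  \<open>n - card F + i\<close> exceeds \<open>n\<close>, the independent products would outgrow, as
  \<open>N\<close> grows, the monomials of the same bounded degree.\<close>

theorem regular_sequence_not_in_var_prime:
  fixes f :: "nat \<Rightarrow> 'k::field mpoly"
  assumes reg: "regular_sequence (poly_ring n) t f" and i: "i \<le> t"
    and F: "F \<subseteq> {1..n}" "card F < i"
  shows "\<exists>j \<in> {1..i}. f j \<notin> var_prime n F"
proof (rule ccontr)
  assume "\<not> ?thesis"
  then have sub: "f ` {1..i} \<subseteq> var_prime n F" by auto
  let ?R = "poly_ring n :: 'k mpoly ring"
  interpret cring ?R by (rule cring_poly_ring)
  have gen: "genideal ?R (f ` {1..i}) \<subseteq> var_prime n F"
    by (rule genideal_minimal[OF ideal_var_prime sub])
  have "\<exists>b. deg_le b p" for p :: "'k mpoly"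
    unfolding deg_le_def by (intro exI[of _ "Max (mon_deg ` Poly_Mapping.keys p)"]) auto
  then have "\<forall>j. \<exists>b. deg_le b (f j)" by blast
  then obtain g where g: "\<And>j. deg_le (g j) (f j)" using choice[of "\<lambda>j b. deg_le b (f j)"] by blast
  define b where "b = Max (g ` {1..i})"
  have b: "deg_le b (f j)" if "1 \<le> j" "j \<le> i" for j
    by (rule deg_le_mono[OF g]) (use that in \<open>auto simp: b_def intro!: Max_ge\<close>)
  have zero: "genideal ?R {} = {0}"
    using genideal_minimal[OF zeroideal, of "{}"] genideal_ideal[of "{}"] poly_ring_idealD(2)
    by (auto simp: poly_ring_simps)
  define k where "k = n - card F"
  \<comment> \<open>The degree bound is \<open>N * C\<close>, so there are at most
    \<open>(N * Suc C) ^ n\<close> monomials. Choosing \<open>N\<close> above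
    \<open>Suc C ^ n\<close> makes this less than \<open>N ^ Suc n\<close>.\<close>
  define C where "C = k + i * b"
  define N where "N = Suc (Suc C ^ n)"
  have "large_mod n ({0} :: 'k mpoly set) (N ^ k * N ^ i) (k * N + i * (N * b))"
    using regular_sequence_large[OF reg i large_mod_mono[OF large_mod_var_prime[OF F(1)] gen] b]
    by (simp add: zero k_def)
  then have le: "N ^ k * N ^ i \<le> Suc (k * N + i * (N * b)) ^ n" by (rule large_mod_zero_le)
  have "Suc n \<le> k + i" using F(2) by (simp add: k_def)
  then have "N ^ Suc n \<le> N ^ (k + i)" by (intro power_increasing) (auto simp: N_def)
  also have "\<dots> \<le> Suc (k * N + i * (N * b)) ^ n" using le by (simp add: power_add)
  also have "\<dots> \<le> (N * Suc C) ^ n"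
  proof (rule power_mono)
    have "Suc (k * N + i * (N * b)) = Suc (N * C)" by (simp add: C_def algebra_simps)
    also have "\<dots> \<le> N * Suc C" by (simp add: N_def)
    finally show "Suc (k * N + i * (N * b)) \<le> N * Suc C" .
  qed simp
  also have "\<dots> = N ^ n * Suc C ^ n" by (rule power_mult_distrib)
  also have "\<dots> < N ^ n * N" by (simp add: N_def)
  finally show False by simp
qed

section \<open>Hilbert functions of monomial ideals\<close>

definition mspan :: "nat \<Rightarrow> (nat \<Rightarrow>\<^sub>0 nat) set \<Rightarrow> 'k::field mpoly set" where
  "mspan n E = {p \<in> carrier (poly_ring n). Poly_Mapping.keys p \<subseteq> E}"

definition up_closed :: "nat \<Rightarrow> (nat \<Rightarrow>\<^sub>0 nat) set \<Rightarrow> bool" where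
  "up_closed n E \<longleftrightarrow> E \<subseteq> mons {1..n} \<and> (\<forall>u \<in> mons {1..n}. \<forall>m \<in> E. u + m \<in> E)"

lemma mspan_add: "p \<in> mspan n E \<Longrightarrow> q \<in> mspan n E \<Longrightarrow> p + q \<in> mspan n E"
  using Poly_Mapping.keys_add[of p q] by (auto simp: mspan_def carrier_add)

lemma zero_mem_mspan: "0 \<in> mspan n E"
  by (simp add: mspan_def)

lemma ideal_mspan:
  assumes "up_closed n E" shows "ideal (mspan n E) (poly_ring n)"
proof (rule poly_ring_idealI)
  fix p q :: "'a mpoly"
  assume p: "p \<in> mspan n E" and q: "q \<in> carrier (poly_ring n)"
  have "m \<in> E" if m: "m \<in> Poly_Mapping.keys (q * p)" for m
  proof -
    obtain a b where "m = a + b" "a \<in> Poly_Mapping.keys q" "b \<in> Poly_Mapping.keys p"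
      using m Poly_Mapping.keys_mult[of q p] by blast
    then show ?thesis using p q assms by (auto simp: mspan_def up_closed_def mons_def mem_carrier)
  qed
  then show "q * p \<in> mspan n E" using p q by (auto simp: mspan_def carrier_mult)
qed (simp_all add: mspan_add zero_mem_mspan, auto simp: mspan_def)

lemma mspan_eq_genideal:
  assumes "up_closed n E"
  shows "mspan n E = genideal (poly_ring n) ((\<lambda>m. Poly_Mapping.single m (1 :: 'k::field)) ` E)"
proof
  let ?R = "poly_ring n :: 'k mpoly ring" and ?G = "(\<lambda>m. Poly_Mapping.single m (1 :: 'k)) ` E"
  interpret cring ?R by (rule cring_poly_ring)
  have G: "?G \<subseteq> mspan n E" "?G \<subseteq> carrier ?R"
    using assms by (auto simp: mspan_def mem_carrier up_closed_def mons_def)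
  show "genideal ?R ?G \<subseteq> mspan n E" by (rule genideal_minimal[OF ideal_mspan[OF assms] G(1)])
  note I = poly_ring_idealD[OF genideal_ideal[OF G(2)]]
  show "mspan n E \<subseteq> genideal ?R ?G"
  proof
    fix p :: "'k mpoly" assume p: "p \<in> mspan n E"
    have "Poly_Mapping.single m c \<in> genideal ?R ?G" if "m \<in> E" for m c
    proof -
      have "Poly_Mapping.single m 1 \<in> genideal ?R ?G" using genideal_self[OF G(2)] that by auto
      from I(4)[OF this carrier_single_0, of c] show ?thesis by (simp add: mult_single)
    qed
    then have "(\<Sum>m \<in> A. Poly_Mapping.single m (Poly_Mapping.lookup p m)) \<in> genideal ?R ?G"
      if "A \<subseteq> E" for A
      using that by (induction A rule: infinite_finite_induct) (auto intro: I(2,3))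
    from this[of "Poly_Mapping.keys p"] p show "p \<in> genideal ?R ?G"
      by (simp add: sum_single_keys mspan_def)
  qed
qed

lemma monomial_ideal_mspan:
  assumes up: "up_closed n E" and "0 \<notin> E"
  shows "monomial_ideal n (mspan n E :: 'k::field mpoly set)"
proof -
  let ?G = "(\<lambda>m. Poly_Mapping.single m (1 :: 'k)) ` E"
  have G: "?G \<subseteq> monomials n"
    using up by (auto simp: monomials_def up_closed_def mons_def)
  have "?G \<subseteq> (\<Union>d. hom_component n d)"
    using up by (auto simp: hom_component_def up_closed_def mons_def)
  moreover have "(1 :: 'k mpoly) \<notin> mspan n E" using assms(2) by (simp add: mspan_def)
  then have "mspan n E \<noteq> carrier (poly_ring n :: 'k mpoly ring)" by (metis carrier_1)
  ultimately show ?thesis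
    unfolding monomial_ideal_def graded_ideal_def
    using ideal_mspan[OF up] mspan_eq_genideal[OF up] G by blast
qed

text \<open>\<open>E\<close> consists of the monomials in \<open>M\<close>. Its span is an ideal
  containing the generators of \<open>M\<close>, and it is itself generated by elements of
  \<open>M\<close>.\<close>

lemma monomial_ideal_eq_mspan:
  assumes "monomial_ideal n (M :: 'k::field mpoly set)"
  obtains E where "up_closed n E" "0 \<notin> E" "M = mspan n E"
proof
  let ?R = "poly_ring n :: 'k mpoly ring"
  let ?E = "{m \<in> mons {1..n}. Poly_Mapping.single m (1 :: 'k) \<in> M}"
  interpret cring ?R by (rule cring_poly_ring)
  have M: "ideal M ?R" "M \<noteq> carrier ?R"
    using assms by (auto simp: monomial_ideal_def graded_ideal_def)
  note I = poly_ring_idealD[OF M(1)]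
  obtain G where G: "G \<subseteq> monomials n" "M = genideal ?R G"
    using assms by (auto simp: monomial_ideal_def)
  show up: "up_closed n ?E"
    unfolding up_closed_def
  proof (intro conjI ballI)
    fix u m assume u: "u \<in> mons {1..n}" and m: "m \<in> ?E"
    have "Poly_Mapping.single u 1 * Poly_Mapping.single m (1 :: 'k) \<in> M"
      using m u by (intro I(4)) (auto simp: mons_def)
    then show "u + m \<in> ?E" using u m by (simp add: mult_single mons_add_iff)
  qed blast
  show "0 \<notin> ?E"
  proof
    assume "0 \<in> ?E"
    then have "p \<in> M" if "p \<in> carrier ?R" for p using I(4)[of 1 p] that by simp
    then show False using M(2) I(1) by blast
  qed
  show "M = mspan n ?E"
  proof
    have "G \<subseteq> mspan n ?E"
    proof
      fix g assume g: "g \<in> G"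
      have "G \<subseteq> carrier ?R" using G(1) by (auto simp: monomials_def)
      then have "g \<in> M" using g G(2) genideal_self by blast
      moreover obtain m where "g = Poly_Mapping.single m 1" "m \<in> mons {1..n}"
        using g G(1) by (auto simp: monomials_def mons_def)
      ultimately show "g \<in> mspan n ?E" by (auto simp: mspan_def mons_def)
    qed
    then show "M \<subseteq> mspan n ?E" using G(2) genideal_minimal[OF ideal_mspan[OF up]] by blast
    have "(\<lambda>m. Poly_Mapping.single m (1 :: 'k)) ` ?E \<subseteq> M" by auto
    then show "mspan n ?E \<subseteq> M"
      unfolding mspan_eq_genideal[OF up] by (rule genideal_minimal[OF M(1)])
  qed
qed

section \<open>The monomials outside the ideal as a basis of the quotient\<close>

lemma coset_eq: "I +>\<^bsub>poly_ring n\<^esub> p = (\<lambda>i. i + p) ` I"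
  by (auto simp: a_r_coset_def' poly_ring_simps)

lemma coset_eq_iff:
  assumes "ideal I (poly_ring n :: 'k::field mpoly ring)"
  shows "I +>\<^bsub>poly_ring n\<^esub> p = I +>\<^bsub>poly_ring n\<^esub> q \<longleftrightarrow> p - q \<in> I"
proof
  note I = poly_ring_idealD[OF assms]
  assume "I +>\<^bsub>poly_ring n\<^esub> p = I +>\<^bsub>poly_ring n\<^esub> q"
  moreover have "p \<in> (\<lambda>i. i + p) ` I" using I(2) by (auto simp: image_iff)
  ultimately show "p - q \<in> I" unfolding coset_eq by auto
next
  note I = poly_ring_idealD[OF assms]
  assume pq: "p - q \<in> I"
  have "i + p \<in> (\<lambda>i. i + q) ` I" if "i \<in> I" for i
    using I(3)[OF that pq] by (intro image_eqI[of _ _ "i + (p - q)"]) auto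
  moreover have "i + q \<in> (\<lambda>i. i + p) ` I" if i: "i \<in> I" for i
  proof -
    have "(i - (p - q)) + (p - q) \<in> I" using i by simp
    then have "i - (p - q) \<in> I" using I(5) pq by blast
    then show ?thesis by (intro image_eqI[of _ _ "i - (p - q)"]) auto
  qed
  ultimately show "I +>\<^bsub>poly_ring n\<^esub> p = I +>\<^bsub>poly_ring n\<^esub> q"
    unfolding coset_eq by blast
qed

lemma keys_subset_insert_iff:
  fixes q :: "'k::field mpoly"
  assumes "m \<notin> T"
  shows "Poly_Mapping.keys q \<subseteq> insert m T \<longleftrightarrow>
    (\<exists>c p. q = Poly_Mapping.single m c + p \<and> Poly_Mapping.keys p \<subseteq> T)"
proof
  assume q: "Poly_Mapping.keys q \<subseteq> insert m T"
  let ?c = "Poly_Mapping.lookup q m"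
  have "Poly_Mapping.keys (q - Poly_Mapping.single m ?c) \<subseteq> T"
  proof
    fix x assume "x \<in> Poly_Mapping.keys (q - Poly_Mapping.single m ?c)"
    then have "x \<noteq> m" "x \<in> Poly_Mapping.keys q"
      by (auto simp: in_keys_iff lookup_minus lookup_single when_def split: if_splits)
    with q show "x \<in> T" by blast
  qed
  then show "\<exists>c p. q = Poly_Mapping.single m c + p \<and> Poly_Mapping.keys p \<subseteq> T"
    by (intro exI[of _ ?c] exI[of _ "q - Poly_Mapping.single m ?c"]) simp
next
  assume "\<exists>c p. q = Poly_Mapping.single m c + p \<and> Poly_Mapping.keys p \<subseteq> T"
  then obtain c p where "q = Poly_Mapping.single m c + p" "Poly_Mapping.keys p \<subseteq> T" by blast
  then show "Poly_Mapping.keys q \<subseteq> insert m T"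
    using Poly_Mapping.keys_add[of "Poly_Mapping.single m c" p] by (auto split: if_splits)
qed

text \<open>The monomials of \<open>T\<close> are added one at a time. The class of a new one is not
  in the span of the earlier ones, because elements of \<open>I\<close> have no term outside
  \<open>E\<close>.\<close>

lemma dimension_cosets:
  fixes E :: "(nat \<Rightarrow>\<^sub>0 nat) set"
  assumes up: "up_closed n E" and T: "finite T" "T \<subseteq> mons {1..n} - E"
  defines "I \<equiv> mspan n E :: 'k::field mpoly set"
  shows "ring.dimension (poly_ring n Quot I) (card T) (quot_scalars n I)
    {I +>\<^bsub>poly_ring n\<^esub> p | p. Poly_Mapping.keys p \<subseteq> T}"
proof -
  let ?R = "poly_ring n :: 'k mpoly ring"
  let ?h = "\<lambda>p. I +>\<^bsub>?R\<^esub> p"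
  have id: "ideal I ?R" unfolding I_def by (rule ideal_mspan[OF up])
  interpret I: ideal I ?R by (rule id)
  interpret Q: ring "?R Quot I" by (rule I.quotient_is_ring)
  have keys_carrier: "p \<in> carrier ?R" if "Poly_Mapping.keys p \<subseteq> mons {1..n}" for p :: "'k mpoly"
    using that by (auto simp: mem_carrier mons_def)
  have Q_simps: "zero (?R Quot I) = I" "add (?R Quot I) = set_add ?R"
    "C \<otimes>\<^bsub>?R Quot I\<^esub> C' = rcoset_mult ?R I C C'" for C C'
    by (simp_all add: FactRing_def)
  have plus: "?h p <+>\<^bsub>?R\<^esub> ?h q = ?h (p + q)" if "p \<in> carrier ?R" "q \<in> carrier ?R" for p q
    using I.a_rcos_sum[OF that] by (simp add: poly_ring_simps)
  have times: "rcoset_mult ?R I (?h p) (?h q) = ?h (p * q)" if "p \<in> carrier ?R" "q \<in> carrier ?R" for p q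
    using I.rcoset_mult_add[OF that] by (simp add: poly_ring_simps)
  show ?thesis using T
  proof (induction T rule: finite_induct)
    case empty
    have "?h 0 = I" by (simp add: coset_eq)
    then have "{?h p | p. Poly_Mapping.keys p \<subseteq> {}} = {\<zero>\<^bsub>?R Quot I\<^esub>}" by (simp add: Q_simps)
    then show ?case using Q.zero_dim by (metis card.empty)
  next
    case (insert m T)
    let ?V = "{?h p | p. Poly_Mapping.keys p \<subseteq> T}"
    let ?m = "Poly_Mapping.single m (1 :: 'k)"
    have m: "m \<in> mons {1..n}" "m \<notin> E" and TE: "T \<subseteq> mons {1..n}" using insert.prems by auto
    have mc: "Poly_Mapping.single m c \<in> carrier ?R" for c using m(1) by (simp add: mons_def)
    have Tc: "p \<in> carrier ?R" if "Poly_Mapping.keys p \<subseteq> T" for p using keys_carrier that TE by blast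
    have "?h ?m \<in> carrier (?R Quot I)"
      using mc[of 1] I.a_rcosetsI[OF I.a_subset] by (simp add: FactRing_def)
    moreover have "?h ?m \<notin> ?V"
    proof
      assume "?h ?m \<in> ?V"
      then obtain p where p: "Poly_Mapping.keys p \<subseteq> T" "?m - p \<in> I"
        using coset_eq_iff[OF id] by blast
      have "m \<notin> Poly_Mapping.keys p" using p(1) insert.hyps(2) by blast
      then have "m \<in> Poly_Mapping.keys (?m - p)" by (simp add: in_keys_iff lookup_minus)
      moreover have "Poly_Mapping.keys (?m - p) \<subseteq> E" using p(2) unfolding I_def mspan_def by blast
      ultimately show False using m(2) by blast
    qed
    moreover have "Q.line_extension (quot_scalars n I) (?h ?m) ?V = {?h p | p. Poly_Mapping.keys p \<subseteq> insert m T}"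
    proof -
      have K: "quot_scalars n I = range (\<lambda>c. ?h (Poly_Mapping.single 0 c))"
        unfolding quot_scalars_def by blast
      have V: "{?h p | p. Poly_Mapping.keys p \<subseteq> A} = ?h ` {p. Poly_Mapping.keys p \<subseteq> A}" for A
        by blast
      have "Q.line_extension (quot_scalars n I) (?h ?m) ?V
          = (\<Union>c. \<Union>p \<in> {p. Poly_Mapping.keys p \<subseteq> T}.
              {rcoset_mult ?R I (?h (Poly_Mapping.single 0 c)) (?h ?m) <+>\<^bsub>?R\<^esub> ?h p})"
        unfolding Q.line_extension_def set_add_def' r_coset_def K V Q_simps by blast
      also have "\<dots> = (\<Union>c. \<Union>p \<in> {p. Poly_Mapping.keys p \<subseteq> T}. {?h (Poly_Mapping.single m c + p)})"
      proof (intro SUP_cong refl)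
        fix c :: 'k and p :: "'k mpoly" assume "p \<in> {p. Poly_Mapping.keys p \<subseteq> T}"
        then have p: "p \<in> carrier ?R" using Tc by blast
        have "Poly_Mapping.single 0 c * ?m = Poly_Mapping.single m c" by (simp add: mult_single)
        then have "rcoset_mult ?R I (?h (Poly_Mapping.single 0 c)) (?h ?m) = ?h (Poly_Mapping.single m c)"
          using times[OF carrier_single_0 mc, of c 1] by (simp only:)
        then show "{rcoset_mult ?R I (?h (Poly_Mapping.single 0 c)) (?h ?m) <+>\<^bsub>?R\<^esub> ?h p}
            = {?h (Poly_Mapping.single m c + p)}"
          using plus[OF mc p, of c] by (simp only:)
      qed
      also have "\<dots> = ?h ` {p. Poly_Mapping.keys p \<subseteq> insert m T}"
        unfolding keys_subset_insert_iff[OF insert.hyps(2)] by blast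
      finally show ?thesis unfolding V .
    qed
    moreover have "Q.dimension (card T) (quot_scalars n I) ?V"
      using insert.IH insert.prems by blast
    ultimately show ?case
      using Q.Suc_dim[of "?h ?m" ?V "card T" "quot_scalars n I"] insert.hyps by simp
  qed
qed

theorem hilbert_function_mspan:
  assumes up: "up_closed n E" and "0 \<notin> E"
  shows "hilbert_function n (mspan n E :: 'k::field mpoly set) d = card (deg_part (mons {1..n} - E) d)"
proof -
  let ?R = "poly_ring n :: 'k mpoly ring" and ?I = "mspan n E :: 'k mpoly set"
  let ?T = "deg_part (mons {1..n} - E) d"
  have id: "ideal ?I ?R" by (rule ideal_mspan[OF up])
  interpret I: ideal ?I ?R by (rule id)
  interpret Q: ring "?R Quot ?I" by (rule I.quotient_is_ring)
  have "?I \<noteq> carrier ?R"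
    using monomial_ideal_mspan[OF assms] unfolding monomial_ideal_def graded_ideal_def by blast
  then have sf: "subfield (quot_scalars n ?I) (?R Quot ?I)" by (rule subfield_quot_scalars[OF id])
  have "quot_component n ?I d = {?I +>\<^bsub>?R\<^esub> p | p. Poly_Mapping.keys p \<subseteq> ?T}"
  proof (intro equalityI subsetI)
    fix C assume "C \<in> quot_component n ?I d"
    then obtain p where p: "p \<in> hom_component n d" "C = ?I +>\<^bsub>?R\<^esub> p"
      by (auto simp: quot_component_def)
    let ?s = "\<lambda>m. Poly_Mapping.single m (Poly_Mapping.lookup p m)"
    \<comment> \<open>Dropping the terms of \<open>p\<close> with monomial in \<open>E\<close> does
      not change its class.\<close>
    let ?q = "\<Sum>m \<in> Poly_Mapping.keys p - E. ?s m"
    have "p = (\<Sum>m \<in> Poly_Mapping.keys p \<inter> E. ?s m) + ?q"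
      using sum.Int_Diff[of "Poly_Mapping.keys p" ?s E] by (simp add: sum_single_keys)
    then have "p - ?q = (\<Sum>m \<in> Poly_Mapping.keys p \<inter> E. ?s m)" by (metis add_diff_cancel_right')
    also have "\<dots> \<in> ?I"
    proof -
      have "?s m \<in> ?I" if "m \<in> Poly_Mapping.keys p \<inter> E" for m
      proof -
        have "m \<in> mons {1..n}" using that up unfolding up_closed_def by blast
        then have "?s m \<in> carrier ?R" unfolding mons_def by (intro carrier_single) blast
        moreover have "Poly_Mapping.keys (?s m) \<subseteq> E" using that by simp
        ultimately show ?thesis unfolding mspan_def by blast
      qed
      then have "(\<Sum>m \<in> A. ?s m) \<in> ?I" if "A \<subseteq> Poly_Mapping.keys p \<inter> E" for A
        using that by (induction A rule: infinite_finite_induct) (auto intro: mspan_add zero_mem_mspan)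
      then show ?thesis by blast
    qed
    finally have "C = ?I +>\<^bsub>?R\<^esub> ?q" using coset_eq_iff[OF id] p(2) by simp
    moreover have "Poly_Mapping.keys ?q \<subseteq> Poly_Mapping.keys p - E"
    proof -
      have "Poly_Mapping.keys (?s m) \<subseteq> {m}" for m by simp
      then show ?thesis using Poly_Mapping.keys_sum[of ?s "Poly_Mapping.keys p - E"] by blast
    qed
    moreover have "Poly_Mapping.keys p - E \<subseteq> ?T"
      using p(1) by (auto simp: hom_component_def deg_part_def mons_def mem_carrier)
    ultimately show "C \<in> {?I +>\<^bsub>?R\<^esub> p | p. Poly_Mapping.keys p \<subseteq> ?T}" by blast
  next
    fix C assume "C \<in> {?I +>\<^bsub>?R\<^esub> p | p. Poly_Mapping.keys p \<subseteq> ?T}"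
    then obtain p where "C = ?I +>\<^bsub>?R\<^esub> p" "Poly_Mapping.keys p \<subseteq> ?T" by blast
    moreover from this(2) have "p \<in> hom_component n d"
      by (auto simp: hom_component_def deg_part_def mons_def mem_carrier)
    ultimately show "C \<in> quot_component n ?I d" by (auto simp: quot_component_def)
  qed
  moreover have "finite ?T" "?T \<subseteq> mons {1..n} - E"
    by (rule finite_deg_part[of "{1..n}"]) (auto simp: deg_part_def)
  ultimately have dim: "Q.dimension (card ?T) (quot_scalars n ?I) (quot_component n ?I d)"
    using dimension_cosets[OF up, of ?T] by simp
  \<comment> \<open>\<open>dim\<close> is a definite description, so uniqueness of the dimension
    over a subfield is needed as well.\<close>
  show ?thesis
    unfolding hilbert_function_def Q.dim_def
    by (rule the_equality, rule dim, rule Q.dimension_is_inj[OF sf _ dim])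
qed

section \<open>The monomial ideal with pure powers\<close>

definition expo :: "nat \<Rightarrow> (nat \<Rightarrow>\<^sub>0 nat) \<Rightarrow> nat list" where
  "expo n m = map (Poly_Mapping.lookup m) [1..<Suc n]"

lemma length_expo [simp]: "length (expo n m) = n"
  by (simp add: expo_def)

lemma nth_expo: "i < n \<Longrightarrow> expo n m ! i = Poly_Mapping.lookup m (Suc i)"
  by (simp add: expo_def del: upt_Suc)

lemma sum_list_expo:
  assumes "m \<in> mons {1..n}" shows "sum_list (expo n m) = mon_deg m"
proof -
  have "sum_list (expo n m) = (\<Sum>i \<in> {1..n}. Poly_Mapping.lookup m i)"
    unfolding expo_def by (subst sum_list_distinct_conv_sum_set) (auto intro!: sum.cong)
  then show ?thesis using mon_deg_sum[OF _ assms] by simp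
qed

lemma bij_betw_expo:
  "bij_betw (expo n) (mons {1..n}) {l. length l = n}"
proof (rule bij_betwI')
  fix u v assume uv: "u \<in> mons {1..n}" "v \<in> mons {1..n}"
  show "expo n u = expo n v \<longleftrightarrow> u = v"
  proof
    assume eq: "expo n u = expo n v"
    show "u = v"
    proof (rule poly_mapping_eqI)
      fix i show "Poly_Mapping.lookup u i = Poly_Mapping.lookup v i"
      proof (cases "i \<in> {1..n}")
        case True
        then show ?thesis using nth_expo[of "i - 1" n u] nth_expo[of "i - 1" n v] eq by auto
      next
        case False
        then have "i \<notin> Poly_Mapping.keys u" "i \<notin> Poly_Mapping.keys v"
          using uv unfolding mons_def by blast+
        then show ?thesis by (simp add: in_keys_iff)
      qed
    qed
  qed simp
next
  fix l :: "nat list" assume "l \<in> {l. length l = n}"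
  then have l: "length l = n" by simp
  let ?m = "\<Sum>j<n. Poly_Mapping.single (Suc j) (l ! j)"
  have "Poly_Mapping.keys (Poly_Mapping.single (Suc j) (l ! j)) \<subseteq> {1..n}" if "j < n" for j
    using that by auto
  then have m: "?m \<in> mons {1..n}"
    unfolding mons_def using Poly_Mapping.keys_sum[of "\<lambda>j. Poly_Mapping.single (Suc j) (l ! j)" "{..<n}"] by blast
  have "l = expo n ?m"
  proof (rule nth_equalityI)
    fix i assume i: "i < length l"
    have "Poly_Mapping.lookup ?m (Suc i) = (\<Sum>j<n. if j = i then l ! j else 0)"
      by (simp add: lookup_sum lookup_single when_def)
    then show "l ! i = expo n ?m ! i" using i l by (simp add: nth_expo)
  qed (simp add: l)
  with m show "\<exists>m \<in> mons {1..n}. l = expo n m" by blast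
qed simp

lemma incr_list_update: "i < length l \<Longrightarrow> incr l (l[i := Suc (l ! i)])"
proof (induction l arbitrary: i)
  case (Cons x l)
  then show ?case by (cases i) auto
qed simp

lemma incr_expo:
  assumes "i \<in> {1..n}" shows "incr (expo n m) (expo n (unit_mon i + m))"
proof -
  have "expo n (unit_mon i + m) = (expo n m)[i - 1 := Suc (expo n m ! (i - 1))]"
    using assms
    by (intro nth_equalityI) (auto simp: nth_expo nth_list_update lookup_add lookup_single when_def)
  moreover have "i - 1 < n" using assms by auto
  ultimately show ?thesis using incr_list_update[of "i - 1" "expo n m"] by simp
qed

lemma box_append_replicate:
  assumes "d < N" "d < N'" shows "box (bs @ replicate k N) d = box (bs @ replicate k N') d"
proof -
  have "m \<in> box (bs @ replicate k N') d"
    if m: "m \<in> box (bs @ replicate k N) d" and "d < N'" for m N N'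
  proof -
    have le: "m ! i \<le> d" if "i < length m" for i
      using m member_le_sum_list[of "m ! i" m] that by (simp add: box_def)
    have "m ! i < (bs @ replicate k N') ! i" if "i < length m" for i
    proof (cases "i < length bs")
      case True
      have "m ! i < (bs @ replicate k N) ! i"
        using m that by (auto simp: box_def list_all2_conv_all_nth)
      with True show ?thesis by (simp add: nth_append)
    next
      case False
      then show ?thesis using le[OF that] m that \<open>d < N'\<close>
        by (auto simp: box_def list_all2_conv_all_nth nth_append)
    qed
    then show ?thesis using m by (auto simp: box_def list_all2_conv_all_nth)
  qed
  from this[OF _ assms(2)] this[OF _ assms(1)] show ?thesis by blast
qed

text \<open>The complement of \<open>E\<close> consists of lexicographic segments, one in each
  degree, with the sizes of the graded pieces of \<open>D\<close>. The growth bound makes it closed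
  under division, and the bounds of the box keep the pure powers out.\<close>

theorem ex_up_closed_with_powers:
  assumes D: "D \<subseteq> mons {1..n}" "down_closed D" "0 \<in> D"
    and t: "length bs \<le> n" and bs: "sorted bs"
    and cover: "\<And>i F. i < length bs \<Longrightarrow> F \<subseteq> {1..n} \<Longrightarrow> card F \<le> i \<Longrightarrow>
      \<exists>m \<in> mons ({1..n} - F) - D. mon_deg m \<le> bs ! i"
  obtains E where "up_closed n E" "0 \<notin> E"
    "\<And>i. i < length bs \<Longrightarrow> Poly_Mapping.single (Suc i) (bs ! i) \<in> E"
    "\<And>d. card (deg_part (mons {1..n} - E) d) = card (deg_part D d)"
proof -
  let ?X = "{1..n}"
  define c where "c d = card (deg_part D d)" for d
  define b where "b = sum_list bs"
  \<comment> \<open>The remaining exponents are unbounded, but in degrees below \<open>N\<close> the bound \<open>N\<close> has no effect.\<close>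
  define as where "as N = bs @ replicate (n - length bs) N" for N
  define B where "B d = box (as (b + d + 2)) d" for d
  define L where "L d = seg (B d) (c d)" for d
  have B_eq: "B d = box (as (b + N)) d" if "d < N" for d N
    unfolding B_def as_def using that by (intro box_append_replicate) auto
  have finB: "finite (B d)" for d unfolding B_def by (rule finite_box)
  have bs_le: "x \<le> b" if "x \<in> set bs" for x
    using that member_le_sum_list unfolding b_def by blast
  have growth: "c d \<le> card (B d) \<and> shadow (L (Suc d)) \<subseteq> L d" for d
  proof -
    \<comment> \<open>\<open>N\<close> lies above both degrees \<open>d\<close> and
      \<open>Suc d\<close>, and above the entries of \<open>bs\<close>, so that \<open>as N\<close>
      is sorted.\<close>
    define N where "N = b + (d + 2)"
    \<comment> \<open>Truncation puts the \<open>N\<close>-th powers of the variables outside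
      \<open>D'\<close>, which the covering condition needs at the positions behind
      \<open>bs\<close>. Degrees up to \<open>Suc d\<close> are unchanged.\<close>
    define D' where "D' = {m \<in> D. mon_deg m < N}"
    have len: "length (as N) = n" using t by (simp add: as_def)
    have sorted: "sorted (as N)"
      using bs bs_le by (force simp: as_def sorted_append N_def)
    have "cover_cond (as N) ?X D'"
      unfolding cover_cond_def len
    proof (intro allI impI)
      fix i F assume i: "i < n" and F: "F \<subseteq> ?X" "card F \<le> i"
      show "\<exists>m \<in> mons (?X - F) - D'. mon_deg m \<le> as N ! i"
      proof (cases "i < length bs")
        case True
        then show ?thesis using cover[OF True F] by (auto simp: as_def nth_append D'_def)
      next
        case False
        have "F \<noteq> ?X" using F(2) i by auto
        then obtain x where "x \<in> ?X - F" using F(1) by blast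
        then show ?thesis using False i
          by (intro bexI[of _ "Poly_Mapping.single x N"])
            (auto simp: as_def nth_append D'_def mons_def)
      qed
    qed
    moreover have "D' \<subseteq> mons ?X" "down_closed D'"
      using D by (auto simp: D'_def down_closed_def)
    ultimately have
      "card (deg_part D' d) \<le> card (box (as N) d)"
      "card (shadow (seg (box (as N) (Suc d)) (card (deg_part D' (Suc d))))) \<le> card (deg_part D' d)"
      using monomial_growth[OF sorted, of ?X D' d] len by auto
    moreover have "deg_part D' e = deg_part D e" if "e \<le> Suc d" for e
      using that by (auto simp: D'_def deg_part_def N_def)
    ultimately have c: "c d \<le> card (B d)" and sh: "card (shadow (L (Suc d))) \<le> c d"
      using B_eq[of d "d + 2"] B_eq[of "Suc d" "d + 2"] by (auto simp: c_def L_def N_def)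
    have "initseg (box (as N) (Suc d)) (L (Suc d))"
      using initseg_seg[OF finB, of "Suc d"] B_eq[of "Suc d" "d + 2"] by (simp add: L_def N_def)
    then have "initseg (B d) (shadow (L (Suc d)))"
      using initseg_shadow B_eq[of d "d + 2"] by (fastforce simp: N_def)
    \<comment> \<open>Both sides are initial segments of \<open>B d\<close>, so comparing sizes
      gives inclusion.\<close>
    then have "shadow (L (Suc d)) \<subseteq> L d"
      unfolding L_def using sh c
      by (intro initseg_card_le_subset[OF finB _ initseg_seg[OF finB]]) (auto simp: L_def card_seg)
    with c show ?thesis by blast
  qed
  define D' where "D' = {m \<in> mons ?X. expo n m \<in> L (mon_deg m)}"
  have L_len: "length l = n \<and> sum_list l = d" if "l \<in> L d" for l d
  proof -
    have "l \<in> B d" using that seg_subset[OF finB] unfolding L_def by blast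
    then show ?thesis using t by (auto simp: B_def as_def box_def dest!: list_all2_lengthD)
  qed
  have step: "m \<in> D'" if m: "unit_mon x + m \<in> D'" for x m
  proof -
    have "unit_mon x \<in> mons ?X \<and> m \<in> mons ?X"
      using m unfolding mons_add_iff[symmetric] by (simp add: D'_def)
    then have x: "x \<in> ?X" "m \<in> mons ?X" by (auto simp: mons_def)
    have "expo n m \<in> shadow (L (Suc (mon_deg m)))"
      using m incr_expo[OF x(1)] by (auto simp: D'_def shadow_def)
    then show ?thesis using growth x(2) by (auto simp: D'_def)
  qed
  have down: "m \<in> D'" if "u + m \<in> D'" for u m
    using that
  proof (induction "mon_deg u" arbitrary: u)
    case 0
    then show ?case by (simp add: mon_deg_eq_0_iff)
  next
    case (Suc k)
    then have "Poly_Mapping.keys u \<noteq> {}" by auto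
    then obtain x where "x \<in> Poly_Mapping.keys u" by blast
    then obtain v where v: "u = unit_mon x + v" using unit_mon_add_minus by metis
    then have "v + m \<in> D'" using step Suc.prems by (simp add: add.assoc)
    then show ?case using Suc v by simp
  qed
  have card: "card (deg_part D' d) = card (deg_part D d)" for d
  proof -
    have "expo n ` deg_part D' d = L d"
    proof (intro equalityI subsetI)
      fix l assume l: "l \<in> L d"
      have "l \<in> expo n ` mons ?X"
        unfolding bij_betw_imp_surj_on[OF bij_betw_expo] using L_len[OF l] by simp
      then obtain m where m: "m \<in> mons ?X" "expo n m = l" by blast
      then have "mon_deg m = d" using sum_list_expo L_len[OF l] by metis
      then show "l \<in> expo n ` deg_part D' d" using l m by (auto simp: D'_def deg_part_def)
    qed (auto simp: D'_def deg_part_def)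
    moreover have "inj_on (expo n) (deg_part D' d)"
      by (rule inj_on_subset[OF bij_betw_imp_inj_on[OF bij_betw_expo]])
        (auto simp: D'_def deg_part_def)
    ultimately have "card (deg_part D' d) = card (L d)" by (metis card_image)
    then show ?thesis using growth[of d] by (simp add: L_def card_seg c_def)
  qed
  have D'_sub: "D' \<subseteq> mons ?X" by (auto simp: D'_def)
  show ?thesis
  proof (rule that[of "mons ?X - D'"])
    show "up_closed n (mons ?X - D')"
      unfolding up_closed_def
    proof (intro conjI ballI)
      fix u m assume "u \<in> mons ?X" and "m \<in> mons ?X - D'"
      then show "u + m \<in> mons ?X - D'" using down[of u m] mons_add_iff[of u m ?X] by blast
    qed blast
    have "deg_part D 0 = {0}" using D(3) by (auto simp: deg_part_def mon_deg_eq_0_iff)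
    then have "card (deg_part D' 0) = 1" using card[of 0] by simp
    then have "deg_part D' 0 \<noteq> {}" by force
    then show "0 \<notin> mons ?X - D'" by (auto simp: deg_part_def mon_deg_eq_0_iff)
    show "card (deg_part (mons ?X - (mons ?X - D')) d) = card (deg_part D d)" for d
      using card D'_sub by (simp add: double_diff)
    fix i assume i: "i < length bs"
    let ?m = "Poly_Mapping.single (Suc i) (bs ! i)"
    \<comment> \<open>Its entry at position \<open>i\<close> equals the bound \<open>bs ! i\<close>,
      while vectors of the box stay strictly below it.\<close>
    have "?m \<notin> D'"
    proof
      assume "?m \<in> D'"
      then have "expo n ?m \<in> L (bs ! i)" by (simp add: D'_def)
      then have "expo n ?m \<in> B (bs ! i)" using seg_subset[OF finB] unfolding L_def by blast
      then have "expo n ?m ! i < (bs @ replicate (n - length bs) (b + bs ! i + 2)) ! i"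
        using i t unfolding B_def as_def box_def by (simp add: list_all2_conv_all_nth)
      then have "expo n ?m ! i < bs ! i" using i by (simp add: nth_append)
      then show False using i t by (simp add: nth_expo)
    qed
    then show "?m \<in> mons ?X - D'" using i t by (auto simp: mons_def)
  qed
qed

section \<open>Monomial ideals containing a regular sequence\<close>

lemma var_power: "(var i :: 'k::field mpoly) ^ k = Poly_Mapping.single (Poly_Mapping.single i k) 1"
proof (induction k)
  case (Suc k)
  then show ?case by (simp add: var_def mult_single flip: single_add)
qed simp

theorem corollary3p5:
  fixes n t :: nat
    and a :: "nat \<Rightarrow> nat"
    and f :: "nat \<Rightarrow> 'k::field mpoly"
    and M :: "'k mpoly set"
  assumes "t \<ge> 1"
    and "\<forall>i \<in> {1..t}. \<forall>j \<in> {1..t}. i \<le> j \<longrightarrow> a i \<le> a j"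
    and "monomial_ideal n M"
    and "regular_sequence (poly_ring n) t f"
    and "\<forall>i \<in> {1..t}. f i \<in> hom_component n (a i)"
    and "\<forall>i \<in> {1..t}. f i \<in> M"
  shows "\<exists>J :: 'k mpoly set. monomial_ideal n J \<and>
           (\<forall>i \<in> {1..t}. var i ^ a i \<in> J) \<and>
           (\<forall>d. hilbert_function n M d = hilbert_function n J d)"
proof -
  obtain E where E: "up_closed n E" "0 \<notin> E" and M: "M = mspan n E"
    using monomial_ideal_eq_mspan[OF assms(3)] .
  have keys_f: "Poly_Mapping.keys (f j) \<subseteq> E" if "j \<in> {1..t}" for j
    using assms(6) that M by (auto simp: mspan_def)
  have EX: "E \<subseteq> mons {1..n}" using E(1) by (simp add: up_closed_def)
  \<comment> \<open>Some \<open>f j\<close> with \<open>j \<le> i\<close> has a term whose monomial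
    avoids \<open>F\<close>. It lies in \<open>E\<close> because \<open>M\<close> is a monomial
    ideal, and its degree \<open>a j\<close> is at most \<open>a i\<close>.\<close>
  have cover: "\<exists>m \<in> E. Poly_Mapping.keys m \<inter> F = {} \<and> mon_deg m \<le> a i"
    if i: "i \<le> t" and F: "F \<subseteq> {1..n}" "card F < i" for i F
  proof -
    obtain j where j: "j \<in> {1..i}" "f j \<notin> var_prime n F"
      using regular_sequence_not_in_var_prime[OF assms(4) i F] by blast
    then have jt: "j \<in> {1..t}" using i by simp
    have hom: "f j \<in> hom_component n (a j)" using assms(5) jt by blast
    then obtain m where m: "m \<in> Poly_Mapping.keys (f j)" "Poly_Mapping.keys m \<inter> F = {}"
      using j(2) by (auto simp: hom_component_def var_prime_def)
    have "mon_deg m = a j" using hom m(1) by (simp add: hom_component_def)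
    moreover have "a j \<le> a i" using assms(2) j(1) jt i by auto
    ultimately show ?thesis using m keys_f[OF jt] by auto
  qed
  \<comment> \<open>If there were more elements than variables, all variables could be avoided at
    once, and the monomial \<open>1\<close> would lie in \<open>M\<close>.\<close>
  have "t \<le> n"
  proof (rule ccontr)
    assume "\<not> t \<le> n"
    then obtain m where "m \<in> E" "Poly_Mapping.keys m \<inter> {1..n} = {}"
      using cover[of t "{1..n}"] by auto
    then have "Poly_Mapping.keys m = {}" using EX unfolding mons_def by blast
    then have "m = 0" by simp
    then show False using \<open>m \<in> E\<close> E(2) by simp
  qed
  define bs where "bs = map a [1..<Suc t]"
  have nth_bs: "bs ! i = a (Suc i)" if "i < t" for i
    using that by (simp add: bs_def del: upt_Suc)
  have len: "length bs = t" by (simp add: bs_def)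
  obtain E' where E': "up_closed n E'" "0 \<notin> E'"
    and pow: "\<And>i. i < length bs \<Longrightarrow> Poly_Mapping.single (Suc i) (bs ! i) \<in> E'"
    and card: "\<And>d. card (deg_part (mons {1..n} - E') d) = card (deg_part (mons {1..n} - E) d)"
  proof (rule ex_up_closed_with_powers)
    show "mons {1..n} - E \<subseteq> mons {1..n}" by blast
    have "v + u \<in> E" if "u \<in> E" "v \<in> mons {1..n}" for u v
      using E(1) that unfolding up_closed_def by blast
    then show "down_closed (mons {1..n} - E)"
      unfolding down_closed_def by (auto simp: mons_add_iff add.commute)
    show "0 \<in> mons {1..n} - E" using E(2) by (simp add: mons_def)
    show "length bs \<le> n" using \<open>t \<le> n\<close> by (simp add: len)
    show "sorted bs" using assms(2) by (auto simp: sorted_iff_nth_mono len nth_bs)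
    fix i F assume i: "i < length bs" and F: "F \<subseteq> {1..n}" "card F \<le> i"
    then obtain m where "m \<in> E" "Poly_Mapping.keys m \<inter> F = {}" "mon_deg m \<le> a (Suc i)"
      using cover[of "Suc i" F] by (auto simp: len)
    then show "\<exists>m \<in> mons ({1..n} - F) - (mons {1..n} - E). mon_deg m \<le> bs ! i"
      using EX i by (intro bexI[of _ m]) (auto simp: len nth_bs mons_def)
  qed blast
  show ?thesis
  proof (intro exI[of _ "mspan n E'"] conjI ballI allI)
    show "monomial_ideal n (mspan n E' :: 'k mpoly set)" by (rule monomial_ideal_mspan[OF E'])
    show "hilbert_function n M d = hilbert_function n (mspan n E' :: 'k mpoly set) d" for d
      unfolding M hilbert_function_mspan[OF E] hilbert_function_mspan[OF E'] card ..
    fix i assume i: "i \<in> {1..t}"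
    then have "Poly_Mapping.single i (a i) \<in> E'" using pow[of "i - 1"] nth_bs[of "i - 1"] len by auto
    then show "var i ^ a i \<in> mspan n E'"
      using i \<open>t \<le> n\<close> by (simp add: var_power mspan_def)
  qed
qed

end
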